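(* For every integer $c_0\ge1$ and every $C>0$ there is a constant $A=A(c_0,C)>0$, depending only on $c_0$ and $C$, such that the following holds. Let $\varphi=c_0s+\psi\in\mathcal G$ with $\mathrm{char}(\varphi)=c_0$ and let $u$ be a Dirichlet series convergent in $\mathbb C_+$. Assume that, on $\mathbb C_+$, \begin{itemize} \item $|u'|\le C$ and $|\psi|\le C$; \item $|u|\le C\,\mathrm{Re}\,\varphi$. \end{itemize} Then the weighted composition operator $uC_\varphi:f\mapsto u\cdot(f\circ\varphi)$ is bounded from $\mathcal A$ to $\mathcal H$ with $\|uC_\varphi\|_{\mathcal A\to\mathcal H}\le A$.
   Context: For $\theta\in\mathbb R$, $\mathbb C_\theta=\{s\in\mathbb C:\ \mathrm{Re}\, s>\theta\}$, $\mathbb C_+=\mathbb C_0$. $\mathcal H$ is the Hilbert space of Dirichlet series $f(s)=\sum_{n\ge1}a_nn^{-s}$ with $\|f\|_{\mathcal H}^2=\sum_n|a_n|^2<\infty$; its elements are analytic on $\mathbb C_{1/2}$. $\mathcal A$ is the completion of the space of Dirichlet polynomials for the norm $\|f\|_{\mathcal A}^2=\int_0^1\|f(\cdot+\sigma)\|_{\mathcal H}^2\,\sigma\,d\sigma$; it is a space of Dirichlet series analytic on $\mathbb C_{1/2}$. The Gordon-Hedenmalm class $\mathcal G$ is the set of maps $\varphi:\mathbb C_{1/2}\to\mathbb C_{1/2}$ of the form $\varphi(s)=c_0s+\psi(s)$, where $c_0=:\mathrm{char}(\varphi)$ is a non-negative integer (the characteristic of $\varphi$) and $\psi(s)=\sum_{n\ge1}c_nn^{-s}$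 converges uniformly in $\mathbb C_\varepsilon$ for every $\varepsilon>0$ and satisfies: (a) if $c_0=0$, then $\psi(\mathbb C_0)\subseteq\mathbb C_{1/2}$; (b) if $c_0\ge1$, then either $\psi\equiv c_1$ with $\mathrm{Re}\,c_1\ge0$ or $\psi(\mathbb C_0)\subseteq\mathbb C_0$. Such $\varphi$ is regarded as an analytic function on $\mathbb C_+$ by the same formula. *)

theory Defs
  imports "HOL-Analysis.Analysis"
begin

text \<open>
  A Dirichlet series is represented by its coefficient sequence \<open>a\<close>, where \<open>a n\<close> is the
  coefficient of \<open>n\<^sup>-\<^sup>s\<close> for \<open>n \<ge> 1\<close>.  The value \<open>a 0\<close> is never used.
\<close>

definition dirichlet_term :: "(nat \<Rightarrow> complex) \<Rightarrow> complex \<Rightarrow> nat \<Rightarrow> complex" where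
  "dirichlet_term a s n = a (Suc n) * of_nat (Suc n) powr (- s)"

definition dirichlet :: "(nat \<Rightarrow> complex) \<Rightarrow> complex \<Rightarrow> complex" where
  "dirichlet a s = (\<Sum>n. dirichlet_term a s n)"

definition half_plane :: "real \<Rightarrow> complex set" where
  "half_plane \<theta> = {s. Re s > \<theta>}"

definition dirichlet_polynomial :: "(nat \<Rightarrow> complex) \<Rightarrow> bool" where
  "dirichlet_polynomial a \<longleftrightarrow> finite {n. a n \<noteq> 0}"

definition dirichlet_translate :: "real \<Rightarrow> (nat \<Rightarrow> complex) \<Rightarrow> nat \<Rightarrow> complex" where
  "dirichlet_translate \<sigma> a n = a n * of_nat n powr (- complex_of_real \<sigma>)"

lemma dirichlet_dirichlet_translate:
  "dirichlet (dirichlet_translate \<sigma> a) s = dirichlet a (s + complex_of_real \<sigma>)"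
proof -
  have "- s - complex_of_real \<sigma> = - complex_of_real \<sigma> + - s"
    by simp
  then show ?thesis
    by (simp only: dirichlet_def dirichlet_term_def dirichlet_translate_def
        powr_add mult.assoc minus_add_distrib diff_conv_add_uminus)
qed

text \<open>
  The squared norms take the value \<open>\<infinity>\<close> on the series outside the respective space.
\<close>

definition H_norm_sq :: "(nat \<Rightarrow> complex) \<Rightarrow> ennreal" where
  "H_norm_sq a = (\<Sum>n. ennreal ((cmod (a (Suc n)))\<^sup>2))"

definition H_space :: "(nat \<Rightarrow> complex) set" where
  "H_space = {a. H_norm_sq a < \<infinity>}"

definition H_norm :: "(nat \<Rightarrow> complex) \<Rightarrow> real" where
  "H_norm a = sqrt (enn2real (H_norm_sq a))"

definition A_norm_sq :: "(nat \<Rightarrow> complex) \<Rightarrow> ennreal" where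
  "A_norm_sq a =
     (\<integral>\<^sup>+\<sigma>\<in>{0..1}. (H_norm_sq (dirichlet_translate \<sigma> a) * ennreal \<sigma>) \<partial>lborel)"

text \<open>
  The completion of the Dirichlet polynomials is realised as their closure, for the extended
  norm, among all Dirichlet series.  Series of finite norm form a weighted \<open>\<ell>\<^sup>2\<close> space, which
  is complete, so this closure is a completion, and its norm is given by the same formula.
\<close>

definition A_space :: "(nat \<Rightarrow> complex) set" where
  "A_space = {a. \<exists>P. (\<forall>k. dirichlet_polynomial (P k)) \<and>
                     (\<lambda>k::nat. A_norm_sq (\<lambda>n. a n - P k n)) \<longlonglongrightarrow> 0}"

definition A_norm :: "(nat \<Rightarrow> complex) \<Rightarrow> real" where
  "A_norm a = sqrt (enn2real (A_norm_sq a))"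

definition gh_map :: "nat \<Rightarrow> (nat \<Rightarrow> complex) \<Rightarrow> complex \<Rightarrow> complex" where
  "gh_map c0 c s = of_nat c0 * s + dirichlet c s"

text \<open>
  \<open>gordon_hedenmalm c0 c\<close> says that the map \<open>gh_map c0 c\<close>, of characteristic \<open>c0\<close> and with
  \<open>\<psi> = dirichlet c\<close>, belongs to the Gordon--Hedenmalm class.
\<close>

definition gordon_hedenmalm :: "nat \<Rightarrow> (nat \<Rightarrow> complex) \<Rightarrow> bool" where
  "gordon_hedenmalm c0 c \<longleftrightarrow>
     gh_map c0 c ` half_plane (1/2) \<subseteq> half_plane (1/2) \<and>
     (\<forall>\<epsilon>>0. uniform_limit (half_plane \<epsilon>)
              (\<lambda>N s. \<Sum>n<N. dirichlet_term c s n) (dirichlet c) sequentially) \<and>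
     (c0 = 0 \<longrightarrow> dirichlet c ` half_plane 0 \<subseteq> half_plane (1/2)) \<and>
     (c0 \<ge> 1 \<longrightarrow>
        (\<forall>s\<in>half_plane 0. dirichlet c s = c 1) \<and> Re (c 1) \<ge> 0 \<or>
        dirichlet c ` half_plane 0 \<subseteq> half_plane 0)"

definition weighted_composition ::
  "(complex \<Rightarrow> complex) \<Rightarrow> (complex \<Rightarrow> complex) \<Rightarrow> (complex \<Rightarrow> complex) \<Rightarrow> complex \<Rightarrow> complex" where
  "weighted_composition u \<phi> f s = u s * f (\<phi> s)"

text \<open>
  \<open>T\<close> acts on functions on \<open>half_plane (1/2)\<close>, where all series in \<open>A_space\<close> and \<open>H_space\<close>
  converge.  The sequence \<open>b\<close> below is the Dirichlet series of \<open>T f\<close>.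
\<close>

definition bounded_A_to_H :: "((complex \<Rightarrow> complex) \<Rightarrow> complex \<Rightarrow> complex) \<Rightarrow> real \<Rightarrow> bool" where
  "bounded_A_to_H T K \<longleftrightarrow>
     (\<forall>a\<in>A_space. \<exists>b\<in>H_space.
        (\<forall>s\<in>half_plane (1/2). T (dirichlet a) s = dirichlet b s) \<and>
        H_norm b \<le> K * A_norm a)"

end

theory Submission
  imports Defs "HOL-Complex_Analysis.Complex_Analysis"
begin

text \<open>
  Write \<open>\<phi> = gh_map c0 c\<close> and \<open>u = dirichlet b\<close>, and let \<open>F = u * (f \<circ> \<phi>)\<close> for a Dirichlet polynomial \<open>f\<close>
  with coefficients \<open>a\<close>.  The heart of the proof is a bound for the mean square of \<open>F\<close> on the vertical
  lines \<open>Re s = \<sigma>\<close> with \<open>0 < \<sigma> \<le> 1\<close> that is uniform in \<open>\<sigma>\<close>.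

  The growth condition on \<open>u\<close> gives \<open>\<bar>F s\<bar>\<^sup>2 \<le> C\<^sup>2 * (Re w)\<^sup>2 * \<bar>f w\<bar>\<^sup>2\<close> at \<open>w = \<phi> s\<close>.  By the mean value
  property on squares, \<open>(Re w)\<^sup>2 * \<bar>f w\<bar>\<^sup>2\<close> is at most a constant times the integral of \<open>\<bar>f z\<bar>\<^sup>2\<close> over the square of
  side \<open>Re w\<close> about \<open>w\<close>, where \<open>Re z * Re (1 / (w + cnj z))\<close> is bounded below.  Hence
  \<open>(Re w)\<^sup>2 * \<bar>f w\<bar>\<^sup>2\<close> is bounded by the integral of \<open>\<bar>f z\<bar>\<^sup>2 * Re z * Re (1 / (w + cnj z))\<close> over a fixed large
  box (\<open>point_evaluation_le_kernel_integral\<close>).  Integrating along the line and exchanging the integrals,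
  one is left with the integral of \<open>Re (1 / (\<phi> s + cnj z))\<close> over the line, which is at most \<open>4 / c0\<close> by
  Cauchy's theorem, because \<open>\<phi> s\<close> stays within a bounded distance of \<open>c0 * s\<close>
  (\<open>kernel_line_integral_le\<close>).  What remains is the mean of \<open>Re z * \<bar>f z\<bar>\<^sup>2\<close> over a strip of bounded width,
  and by orthogonality of the functions \<open>n powr (\<i> * y)\<close> this is at most a constant times the squared
  norm of \<open>f\<close> in \<open>A_space\<close> (\<open>mean_square_weighted_composition_le\<close>).

  To read off coefficients, one notes that \<open>F\<close> is a uniform limit of Dirichlet polynomials far to the
  right, so that it has a Dirichlet series there whose coefficients are means of \<open>F s * n powr s\<close> over a vertical
  line (\<open>dirichlet_approximable_coefficients\<close>).  Since \<open>F\<close> is bounded on \<open>half_plane 0\<close>, the line can be moved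
  towards the imaginary axis (\<open>coeff_mean_shift\<close>), and Bessel's inequality bounds the norm of the
  series in \<open>H_space\<close> by the mean square (\<open>bessel_inequality_mean\<close>).  Analytic continuation identifies
  the series with \<open>F\<close> on \<open>half_plane (1/2)\<close>.

  The coefficient means depend linearly on \<open>f\<close>, so the images of the truncations of an element of
  \<open>A_space\<close> form a Cauchy sequence, whose limit is the required series
  (\<open>bounded_weighted_composition\<close>).  The resulting norm bound is \<open>12 * C * (c0 + C)\<close>.
\<close>

section \<open>Integrals over rectangles\<close>

lemma contour_integral_linepath_same_Im:
  assumes "a < b"
  shows "contour_integral (linepath (Complex a c) (Complex b c)) f =
           integral {a..b} (\<lambda>x. f (Complex x c))"
proof -
  have "contour_integral (linepath (Complex a c) (Complex b c)) f =
      of_real (b - a) * integral {0..1} (\<lambda>x. f (Complex ((b - a) * x + a) c))"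
  proof -
    have "Complex b c - Complex a c = of_real (b - a)"
      by (simp add: complex_eq_iff)
    moreover have "linepath (Complex a c) (Complex b c) x = Complex ((b - a) * x + a) c" for x
      by (simp add: linepath_def complex_eq_iff algebra_simps)
    ultimately show ?thesis
      by (simp add: contour_integral_integral)
  qed
  also have "integral {0..1} (\<lambda>x. f (Complex ((b - a) * x + a) c)) =
      integral {0..(b - a) / (b - a)} (\<lambda>x. f (Complex ((b - a) * x + a) c))"
    using assms by simp
  also have "{0..(b - a) / (b - a)} = (\<lambda>x. x / (b - a)) ` {0..b - a}"
    using assms by simp
  also have "integral \<dots> (\<lambda>x. f (Complex ((b - a) * x + a) c)) =
      integral {a - a..b - a} (\<lambda>x. f (Complex (x + a) c)) / of_real (b - a)"
    using assms by (subst integral_stretch_real) (auto simp: scaleR_conv_of_real)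
  also have "integral {a - a..b - a} (\<lambda>x. f (Complex (x + a) c)) =
      integral {a..b} (\<lambda>x. f (Complex x c))"
    by (rule integral_shift_real_ivl)
  finally show ?thesis
    using assms by (simp del: of_real_diff)
qed

lemma contour_integral_rectpath:
  assumes "a < b" "c < d"
    and cont: "continuous_on (path_image (rectpath (Complex a c) (Complex b d))) g"
  shows "contour_integral (rectpath (Complex a c) (Complex b d)) g =
      integral {a..b} (\<lambda>x. g (Complex x c)) + \<i> * integral {c..d} (\<lambda>y. g (Complex b y))
      - integral {a..b} (\<lambda>x. g (Complex x d)) - \<i> * integral {c..d} (\<lambda>y. g (Complex a y))"
proof -
  have im: "path_image (rectpath (Complex a c) (Complex b d)) =
      closed_segment (Complex a c) (Complex b c) \<union> closed_segment (Complex b c) (Complex b d) \<union>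
      closed_segment (Complex b d) (Complex a d) \<union> closed_segment (Complex a d) (Complex a c)"
    by (simp add: rectpath_def Let_def path_image_join Un_assoc)
  have int: "g contour_integrable_on linepath (Complex a c) (Complex b c)"
    "g contour_integrable_on linepath (Complex b c) (Complex b d)"
    "g contour_integrable_on linepath (Complex b d) (Complex a d)"
    "g contour_integrable_on linepath (Complex a d) (Complex a c)"
    by (rule contour_integrable_continuous_linepath, rule continuous_on_subset[OF cont],
        unfold im, blast)+
  have "contour_integral (rectpath (Complex a c) (Complex b d)) g =
      contour_integral (linepath (Complex a c) (Complex b c)) g +
      contour_integral (linepath (Complex b c) (Complex b d)) g +
      contour_integral (linepath (Complex b d) (Complex a d)) g +
      contour_integral (linepath (Complex a d) (Complex a c)) g"
    using int by (simp add: rectpath_def Let_def)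
  also have "contour_integral (linepath (Complex b d) (Complex a d)) g =
      - contour_integral (linepath (Complex a d) (Complex b d)) g"
    using contour_integral_reversepath[of "linepath (Complex a d) (Complex b d)" g] by simp
  also have "contour_integral (linepath (Complex a d) (Complex a c)) g =
      - contour_integral (linepath (Complex a c) (Complex a d)) g"
    using contour_integral_reversepath[of "linepath (Complex a c) (Complex a d)" g] by simp
  finally show ?thesis
    using assms
    by (simp add: contour_integral_linepath_same_Im
        contour_integral_linepath_same_Re[of _ b _ c d] contour_integral_linepath_same_Re[of _ a _ c d])
qed

text \<open>
  The form in which Cauchy's theorem is used to move an integral from one vertical line to another:
  the horizontal sides appear as error terms.
\<close>
lemma rectangle_integrals_cancel:
  assumes ab: "a < b" and cd: "c < d" and S: "convex S" and holo: "g holomorphic_on S"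
    and sub: "cbox (Complex a c) (Complex b d) \<subseteq> S"
  shows "\<i> * integral {c..d} (\<lambda>y. g (Complex a y)) =
      integral {a..b} (\<lambda>x. g (Complex x c)) - integral {a..b} (\<lambda>x. g (Complex x d))
      + \<i> * integral {c..d} (\<lambda>y. g (Complex b y))"
proof -
  have im: "path_image (rectpath (Complex a c) (Complex b d)) \<subseteq> S"
    using path_image_rectpath_subset_cbox[of "Complex a c" "Complex b d"] ab cd sub by force
  have "contour_integral (rectpath (Complex a c) (Complex b d)) g = 0"
    by (intro contour_integral_unique Cauchy_theorem_convex_simple[OF holo S _ im]) auto
  then show ?thesis
    using contour_integral_rectpath[OF ab cd, of g]
      continuous_on_subset[OF holomorphic_on_imp_continuous_on[OF holo] im]
    by (simp add: algebra_simps)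
qed

text \<open>
  Cauchy's integral formula for \<open>f\<^sup>2\<close>, in which \<open>1 / (z - w)\<close> is at most \<open>1 / r\<close> on the boundary of the square.
  Squares replace the circles of the usual mean value property, because averaging over their size
  produces an area integral in Cartesian coordinates without any change of variables.
\<close>
lemma norm_sq_le_square_boundary:
  fixes f :: "complex \<Rightarrow> complex"
  assumes holo: "f holomorphic_on UNIV" and r: "r > 0"
  defines "g \<equiv> (\<lambda>x y. (cmod (f (Complex x y)))\<^sup>2)"
  shows "2 * pi * r * g u v \<le>
      integral {u-r..u+r} (\<lambda>x. g x (v-r)) + integral {v-r..v+r} (\<lambda>y. g (u+r) y)
      + integral {u-r..u+r} (\<lambda>x. g x (v+r)) + integral {v-r..v+r} (\<lambda>y. g (u-r) y)"
proof -
  define w where "w = Complex u v"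
  define h where "h = (\<lambda>z. (f z)\<^sup>2 / (z - w))"
  let ?R = "rectpath (Complex (u-r) (v-r)) (Complex (u+r) (v+r))"
  have contf: "continuous_on A f" for A
    using holo holomorphic_on_imp_continuous_on holomorphic_on_subset by blast
  have im: "path_image ?R = {z. Re z \<in> {u-r,u+r} \<and> Im z \<in> {v-r..v+r}} \<union>
           {z. Im z \<in> {v-r,v+r} \<and> Re z \<in> {u-r..u+r}}"
    using r by (subst path_image_rectpath) auto
  have nw: "w \<notin> path_image ?R"
    using r by (auto simp: im w_def)
  have wn: "winding_number ?R w = 1"
    by (rule winding_number_rectpath) (use r in \<open>auto simp: in_box_complex_iff w_def\<close>)
  have "((\<lambda>z. (f z)\<^sup>2 / (z - w)) has_contour_integral
      (2 * pi * \<i> * winding_number ?R w * (f w)\<^sup>2)) ?R"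
    by (rule Cauchy_integral_formula_convex_simple[where S = UNIV])
      (use nw holo in \<open>auto intro!: holomorphic_intros\<close>)
  then have eq: "contour_integral ?R h = 2 * pi * \<i> * (f w)\<^sup>2"
    by (simp add: wn h_def contour_integral_unique)
  have conth: "continuous_on (path_image ?R) h"
    unfolding h_def using nw by (intro continuous_intros contf) auto
  have rect: "contour_integral ?R h =
      integral {u-r..u+r} (\<lambda>x. h (Complex x (v-r))) + \<i> * integral {v-r..v+r} (\<lambda>y. h (Complex (u+r) y))
      - integral {u-r..u+r} (\<lambda>x. h (Complex x (v+r))) - \<i> * integral {v-r..v+r} (\<lambda>y. h (Complex (u-r) y))"
    by (rule contour_integral_rectpath) (use r conth in auto)
  have Cx: "continuous_on A (\<lambda>x. Complex x c)" for A c
    by (simp add: Complex_eq) (intro continuous_intros)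
  have Cy: "continuous_on A (\<lambda>y. Complex c y)" for A c
    by (simp add: Complex_eq) (intro continuous_intros)
  have far: "cmod (h z) \<le> (cmod (f z))\<^sup>2 / r" if "z \<in> path_image ?R" for z
  proof -
    have "r \<le> \<bar>Re (z - w)\<bar> \<or> r \<le> \<bar>Im (z - w)\<bar>"
      using that r by (auto simp: im w_def)
    then have "r \<le> cmod (z - w)"
      using abs_Re_le_cmod[of "z - w"] abs_Im_le_cmod[of "z - w"] by linarith
    then show ?thesis
      using r by (simp add: h_def norm_divide norm_power frac_le)
  qed
  have hor: "cmod (integral {u-r..u+r} (\<lambda>x. h (Complex x c))) \<le> integral {u-r..u+r} (\<lambda>x. g x c) / r"
    if "c \<in> {v-r,v+r}" for c
  proof -
    have "cmod (integral {u-r..u+r} (\<lambda>x. h (Complex x c))) \<le> integral {u-r..u+r} (\<lambda>x. g x c / r)"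
    proof (rule integral_norm_bound_integral)
      show "(\<lambda>x. h (Complex x c)) integrable_on {u-r..u+r}"
        by (intro integrable_continuous_interval continuous_on_compose2[OF conth Cx])
          (use that in \<open>auto simp: im\<close>)
      show "(\<lambda>x. g x c / r) integrable_on {u-r..u+r}"
        unfolding g_def using r
        by (intro integrable_continuous_interval continuous_intros continuous_on_compose2[OF contf Cx]) auto
      show "cmod (h (Complex x c)) \<le> g x c / r" if "x \<in> {u-r..u+r}" for x
        unfolding g_def by (rule far) (use that \<open>c \<in> _\<close> in \<open>auto simp: im\<close>)
    qed
    then show ?thesis by simp
  qed
  have ver: "cmod (integral {v-r..v+r} (\<lambda>y. h (Complex c y))) \<le> integral {v-r..v+r} (\<lambda>y. g c y) / r"
    if "c \<in> {u-r,u+r}" for c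
  proof -
    have "cmod (integral {v-r..v+r} (\<lambda>y. h (Complex c y))) \<le> integral {v-r..v+r} (\<lambda>y. g c y / r)"
    proof (rule integral_norm_bound_integral)
      show "(\<lambda>y. h (Complex c y)) integrable_on {v-r..v+r}"
        by (intro integrable_continuous_interval continuous_on_compose2[OF conth Cy])
          (use that in \<open>auto simp: im\<close>)
      show "(\<lambda>y. g c y / r) integrable_on {v-r..v+r}"
        unfolding g_def using r
        by (intro integrable_continuous_interval continuous_intros continuous_on_compose2[OF contf Cy]) auto
      show "cmod (h (Complex c y)) \<le> g c y / r" if "y \<in> {v-r..v+r}" for y
        unfolding g_def by (rule far) (use that \<open>c \<in> _\<close> in \<open>auto simp: im\<close>)
    qed
    then show ?thesis by simp
  qed
  have "2 * pi * g u v = cmod (contour_integral ?R h)"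
    by (simp add: eq norm_mult norm_power g_def w_def)
  also have "\<dots> \<le> cmod (integral {u-r..u+r} (\<lambda>x. h (Complex x (v-r))))
      + cmod (\<i> * integral {v-r..v+r} (\<lambda>y. h (Complex (u+r) y)))
      + cmod (integral {u-r..u+r} (\<lambda>x. h (Complex x (v+r))))
      + cmod (\<i> * integral {v-r..v+r} (\<lambda>y. h (Complex (u-r) y)))"
    unfolding rect by (intro norm_triangle_le_diff norm_triangle_le order_refl add_mono)
  also have "\<dots> \<le> integral {u-r..u+r} (\<lambda>x. g x (v-r)) / r + integral {v-r..v+r} (\<lambda>y. g (u+r) y) / r
      + integral {u-r..u+r} (\<lambda>x. g x (v+r)) / r + integral {v-r..v+r} (\<lambda>y. g (u-r) y) / r"
    using hor[of "v-r"] hor[of "v+r"] ver[of "u-r"] ver[of "u+r"] by (simp add: norm_mult)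
  finally have "2 * pi * g u v * r \<le> (integral {u-r..u+r} (\<lambda>x. g x (v-r)) / r + integral {v-r..v+r} (\<lambda>y. g (u+r) y) / r
      + integral {u-r..u+r} (\<lambda>x. g x (v+r)) / r + integral {v-r..v+r} (\<lambda>y. g (u-r) y) / r) * r"
    using r by (intro mult_right_mono) auto
  also have "\<dots> = integral {u-r..u+r} (\<lambda>x. g x (v-r)) + integral {v-r..v+r} (\<lambda>y. g (u+r) y)
      + integral {u-r..u+r} (\<lambda>x. g x (v+r)) + integral {v-r..v+r} (\<lambda>y. g (u-r) y)"
    using r by (simp add: distrib_right)
  finally show ?thesis
    by (simp add: mult_ac)
qed

section \<open>Mean values over squares\<close>

text \<open>
  Combines the contributions of two opposite sides of a growing square.
\<close>
lemma integral_symmetric_fold: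
  fixes Y :: "real \<Rightarrow> real"
  assumes r: "0 \<le> r" and cont: "continuous_on {v-r..v+r} Y"
  shows "((\<lambda>\<rho>. Y (v - \<rho>) + Y (v + \<rho>)) has_integral integral {v-r..v+r} Y) {0..r}"
proof -
  have int: "Y integrable_on {v-r..v+r}"
    by (rule integrable_continuous_interval[OF cont])
  have A: "((\<lambda>\<rho>. Y (v + \<rho>)) has_integral integral {v..v+r} Y) {0..r}"
  proof -
    have "(Y has_integral integral {v..v+r} Y) {v..v+r}"
      using integrable_on_subinterval[OF int, of v "v+r"] r by (simp add: integrable_integral)
    from has_integral_shift_real_ivl[OF this, of v] show ?thesis
      by (simp only: add.commute[of _ v] diff_self add_diff_cancel_left')
  qed
  have B: "((\<lambda>\<rho>. Y (v - \<rho>)) has_integral integral {v-r..v} Y) {0..r}"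
  proof -
    have "(Y has_integral integral {v-r..v} Y) {v-r..v}"
      using integrable_on_subinterval[OF int, of "v-r" v] r by (simp add: integrable_integral)
    moreover have "v - r - v = - r" by simp
    ultimately have "((\<lambda>\<rho>. Y (\<rho> + v)) has_integral integral {v-r..v} Y) {-r..v-v}"
      using has_integral_shift_real_ivl[of Y "integral {v-r..v} Y" "v-r" v v] by metis
    then have "((\<lambda>\<rho>. Y (v - (- \<rho>))) has_integral integral {v-r..v} Y) {-r..-0}"
      by (simp only: diff_minus_eq_add add.commute[of _ v] diff_self minus_zero)
    then show ?thesis
      by (simp only: has_integral_reflect_real[of "\<lambda>\<rho>. Y (v - \<rho>)"])
  qed
  have "integral {v-r..v} Y + integral {v..v+r} Y = integral {v-r..v+r} Y"
    using r int by (intro Henstock_Kurzweil_Integration.integral_combine) auto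
  with has_integral_add[OF B A] show ?thesis
    by (simp only:)
qed

text \<open>
  Integrate the estimate over the boundaries of the concentric squares of half side \<open>\<rho>\<close> for \<open>\<rho>\<close> between
  \<open>0\<close> and \<open>r\<close>.  Each of the four sides is extended to the full width of the large square; the two
  horizontal sides then sweep the large square once, and so do the two vertical ones.
\<close>
lemma norm_sq_le_square_average:
  fixes f :: "complex \<Rightarrow> complex"
  assumes holo: "f holomorphic_on UNIV" and r: "r > 0"
  shows "r\<^sup>2 * (cmod (f (Complex u v)))\<^sup>2 \<le>
      integral (cbox (u-r, v-r) (u+r, v+r)) (\<lambda>p. (cmod (f (Complex (fst p) (snd p))))\<^sup>2)"
proof -
  define g where "g = (\<lambda>x y. (cmod (f (Complex x y)))\<^sup>2)"
  define I where "I = integral (cbox (u-r, v-r) (u+r, v+r)) (\<lambda>p. g (fst p) (snd p))"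
  define Y where "Y = (\<lambda>y. integral {u-r..u+r} (\<lambda>x. g x y))"
  define Z where "Z = (\<lambda>x. integral {v-r..v+r} (\<lambda>y. g x y))"
  have contf: "continuous_on UNIV f"
    using holo holomorphic_on_imp_continuous_on by blast
  have contg: "continuous_on A (\<lambda>p. g (a p) (b p))"
    if "continuous_on A a" "continuous_on A b" for A :: "'t::topological_space set" and a b
    unfolding g_def Complex_eq
    by (intro continuous_intros continuous_on_compose2[OF contf] that) auto
  have g0: "g x y \<ge> 0" for x y
    by (simp add: g_def)
  have gint: "g x integrable_on {a..b}" "(\<lambda>x. g x y) integrable_on {a..b}" for x y a b
    by (intro integrable_continuous_interval contg continuous_intros)+
  have contY: "continuous_on UNIV Y"
    unfolding Y_def
    by (rule integral_continuous_on_param[of UNIV "u-r" "u+r" "\<lambda>y x. g x y", simplified])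
      (unfold case_prod_beta, intro contg continuous_intros)
  have contZ: "continuous_on UNIV Z"
    unfolding Z_def
    by (rule integral_continuous_on_param[of UNIV "v-r" "v+r" "\<lambda>x y. g x y", simplified])
      (unfold case_prod_beta, intro contg continuous_intros)
  have "I = integral {u-r..u+r} Z"
    unfolding I_def Z_def
    by (subst integral_prod_continuous) (auto intro!: contg continuous_intros)
  also have "\<dots> = integral {v-r..v+r} Y"
    unfolding Z_def Y_def
    by (rule integral_swap_continuous[of "u-r" "v-r" "u+r" "v+r" g, simplified])
      (unfold case_prod_beta, intro contg continuous_intros)
  finally have IY: "I = integral {v-r..v+r} Y" .
  have IZ: "I = integral {u-r..u+r} Z" by fact
  have le: "2 * pi * \<rho> * g u v \<le> (Y (v-\<rho>) + Y (v+\<rho>)) + (Z (u-\<rho>) + Z (u+\<rho>))"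
    if "\<rho> \<in> {0..r}" for \<rho>
  proof -
    have "integral {u-\<rho>..u+\<rho>} (\<lambda>x. g x y) \<le> Y y" "integral {v-\<rho>..v+\<rho>} (\<lambda>y. g x y) \<le> Z x" for x y
      unfolding Y_def Z_def using that g0 gint by (auto intro!: integral_subset_le)
    note this(1)[of "v-\<rho>"] this(1)[of "v+\<rho>"] this(2)[of "u-\<rho>"] this(2)[of "u+\<rho>"]
    moreover have "2 * pi * \<rho> * g u v \<le> integral {u-\<rho>..u+\<rho>} (\<lambda>x. g x (v-\<rho>))
        + integral {v-\<rho>..v+\<rho>} (\<lambda>y. g (u+\<rho>) y)
        + integral {u-\<rho>..u+\<rho>} (\<lambda>x. g x (v+\<rho>)) + integral {v-\<rho>..v+\<rho>} (\<lambda>y. g (u-\<rho>) y)"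
    proof (cases "\<rho> = 0")
      case False
      then show ?thesis
        using norm_sq_le_square_boundary[OF holo, of \<rho> u v] that by (simp add: g_def)
    qed simp
    ultimately show ?thesis by linarith
  qed
  have S: "((\<lambda>\<rho>. (Y (v-\<rho>) + Y (v+\<rho>)) + (Z (u-\<rho>) + Z (u+\<rho>))) has_integral (I + I)) {0..r}"
    using r by (intro has_integral_add integral_symmetric_fold[of r v Y, folded IY]
        integral_symmetric_fold[of r u Z, folded IZ] continuous_on_subset[OF contY]
        continuous_on_subset[OF contZ]) auto
  have "((\<lambda>\<rho>. 2 * pi * \<rho> * g u v) has_integral (pi * r\<^sup>2 * g u v - pi * 0\<^sup>2 * g u v)) {0..r}"
    using r
    by (intro fundamental_theorem_of_calculus)
      (auto intro!: derivative_eq_intros simp flip: has_real_derivative_iff_has_vector_derivative)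
  from has_integral_le[OF this S le] have "pi * r\<^sup>2 * g u v \<le> I + I"
    by simp
  moreover have "2 * (r\<^sup>2 * g u v) \<le> pi * (r\<^sup>2 * g u v)"
    using pi_ge_two g0 by (intro mult_right_mono) auto
  ultimately show ?thesis
    by (simp add: g_def I_def algebra_simps)
qed

section \<open>Integrals along the image of a vertical line\<close>

lemma half_plane_properties:
  "open (half_plane \<theta>)" "convex (half_plane \<theta>)" "connected (half_plane \<theta>)"
proof -
  show "open (half_plane \<theta>)" "convex (half_plane \<theta>)"
    by (auto simp: half_plane_def open_halfspace_Re_gt convex_halfspace_Re_gt)
  then show "connected (half_plane \<theta>)"
    by (simp add: convex_connected)
qed

lemma continuous_on_Complex [continuous_intros]:
  assumes "continuous_on A a" "continuous_on A b"
  shows "continuous_on A (\<lambda>p. Complex (a p) (b p))"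
  unfolding Complex_eq by (intro continuous_intros assms)

text \<open>
  This is the Carleson measure property of the image of a vertical line under \<open>\<phi>\<close>, tested against the
  kernels \<open>1 / (w + cnj z)\<close>.  The integrand is the real part of the holomorphic function
  \<open>g = 1 / (\<phi> + cnj z)\<close>, which is positive and behaves like \<open>1 / (k * s)\<close> at infinity.  Positivity allows
  the segment to be enlarged to \<open>{-U..U}\<close>, and Cauchy's theorem replaces it by three sides of a rectangle
  of total length \<open>4 * U\<close>, on which \<open>\<bar>g\<bar>\<close> is about \<open>1 / (k * U)\<close>.
\<close>
lemma kernel_line_integral_le:
  fixes \<phi> :: "complex \<Rightarrow> complex"
  assumes holo: "\<phi> holomorphic_on half_plane 0"
    and pos: "\<And>s. s \<in> half_plane 0 \<Longrightarrow> Re (\<phi> s) > 0"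
    and near: "\<And>s. s \<in> half_plane 0 \<Longrightarrow> cmod (\<phi> s - of_real k * s) \<le> C"
    and k: "k > 0" and \<sigma>: "\<sigma> > 0" and z: "Re z \<ge> 0"
  shows "integral {-T..T} (\<lambda>t. Re (1 / (\<phi> (Complex \<sigma> t) + cnj z))) \<le> 4 / k"
proof (cases "T > 0")
  case True
  define g where "g = (\<lambda>s. 1 / (\<phi> s + cnj z))"
  define L where "L = C + cmod z"
  have nz: "Re (\<phi> s + cnj z) > 0" if "s \<in> half_plane 0" for s
    using pos[OF that] z by simp
  then have nz': "\<phi> s + cnj z \<noteq> 0" if "s \<in> half_plane 0" for s
    using that by fastforce
  have gholo: "g holomorphic_on half_plane 0"
    unfolding g_def by (intro holomorphic_intros holo nz')
  have gcont: "continuous_on (half_plane 0) g"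
    using gholo by (rule holomorphic_on_imp_continuous_on)
  have line: "continuous_on A (\<lambda>t. g (Complex \<sigma> t))" for A
    using \<sigma> by (intro continuous_on_compose2[OF gcont] continuous_intros) (auto simp: half_plane_def)
  have gpos: "Re (g s) \<ge> 0" if "s \<in> half_plane 0" for s
    unfolding g_def using nz[OF that] by (simp add: Re_divide)
  define I where "I = integral {-T..T} (\<lambda>t. Re (g (Complex \<sigma> t)))"
  have main: "I * (k - L / U) \<le> 4" if U: "U \<ge> T" "k * U > L" for U
  proof -
    define B where "B = 1 / (k * U - L)"
    have Upos: "U > 0" using U True by simp
    have B: "cmod (g s) \<le> B" if "s \<in> half_plane 0" "cmod s \<ge> U" for s
    proof -
      have "k * U \<le> k * cmod s"
        using that k by simp
      also have "\<dots> = cmod (of_real k * s)"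
        using k by (simp add: norm_mult)
      also have "\<dots> \<le> cmod (\<phi> s + cnj z) + cmod (\<phi> s - of_real k * s) + cmod z"
        using norm_triangle_ineq4[of "\<phi> s + cnj z" "\<phi> s - of_real k * s + cnj z"]
          norm_triangle_ineq[of "\<phi> s - of_real k * s" "cnj z"] by simp
      also have "\<dots> \<le> cmod (\<phi> s + cnj z) + L"
        using near[OF that(1)] by (simp add: L_def)
      finally show ?thesis
        using U by (simp add: g_def B_def norm_divide frac_le)
    qed
    have Bpos: "B \<ge> 0" using U by (simp add: B_def)
    have side: "cmod (integral {a..b} (\<lambda>x. g (h x))) \<le> B * (b - a)"
      if "a \<le> b" "continuous_on {a..b} h" "\<And>x. x \<in> {a..b} \<Longrightarrow> h x \<in> half_plane 0"
        "\<And>x. x \<in> {a..b} \<Longrightarrow> cmod (h x) \<ge> U" for a b h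
    proof (rule integral_bound)
      show "continuous_on {a..b} (\<lambda>x. g (h x))"
        by (rule continuous_on_compose2[OF gcont that(2)]) (use that in auto)
      show "\<And>t. t \<in> {a..b} \<Longrightarrow> cmod (g (h t)) \<le> B"
        using B that by blast
    qed (use that in auto)
    have far: "U \<le> cmod (Complex x y)" if "U \<le> \<bar>x\<bar> \<or> U \<le> \<bar>y\<bar>" for x y
      using that abs_Re_le_cmod[of "Complex x y"] abs_Im_le_cmod[of "Complex x y"] by auto
    have cx: "continuous_on A (\<lambda>x. Complex x c)" and cy: "continuous_on A (\<lambda>x. Complex c x)" for A c
      by (intro continuous_intros)+
    have "\<i> * integral {-U..U} (\<lambda>y. g (Complex \<sigma> y)) =
      integral {\<sigma>..\<sigma>+U} (\<lambda>x. g (Complex x (-U))) - integral {\<sigma>..\<sigma>+U} (\<lambda>x. g (Complex x U))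
      + \<i> * integral {-U..U} (\<lambda>y. g (Complex (\<sigma>+U) y))"
      by (rule rectangle_integrals_cancel[OF _ _ half_plane_properties(2) gholo])
        (use Upos \<sigma> in \<open>auto simp: half_plane_def in_cbox_complex_iff\<close>)
    then have "cmod (integral {-U..U} (\<lambda>y. g (Complex \<sigma> y))) =
      cmod (integral {\<sigma>..\<sigma>+U} (\<lambda>x. g (Complex x (-U))) - integral {\<sigma>..\<sigma>+U} (\<lambda>x. g (Complex x U))
      + \<i> * integral {-U..U} (\<lambda>y. g (Complex (\<sigma>+U) y)))"
      by (metis norm_mult norm_ii mult_1)
    also have "\<dots> \<le> cmod (integral {\<sigma>..\<sigma>+U} (\<lambda>x. g (Complex x (-U))))
        + cmod (integral {\<sigma>..\<sigma>+U} (\<lambda>x. g (Complex x U)))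
        + cmod (\<i> * integral {-U..U} (\<lambda>y. g (Complex (\<sigma>+U) y)))"
      by (intro norm_triangle_le add_mono norm_triangle_ineq4 order_refl)
    also have "\<dots> \<le> B * U + B * U + B * (2 * U)"
    proof (intro add_mono)
      show "cmod (integral {\<sigma>..\<sigma>+U} (\<lambda>x. g (Complex x (-U)))) \<le> B * U"
        "cmod (integral {\<sigma>..\<sigma>+U} (\<lambda>x. g (Complex x U))) \<le> B * U"
        using side[of \<sigma> "\<sigma>+U" "\<lambda>x. Complex x (-U)", OF _ cx]
          side[of \<sigma> "\<sigma>+U" "\<lambda>x. Complex x U", OF _ cx] Upos \<sigma> far
        by (auto simp: half_plane_def)
      show "cmod (\<i> * integral {-U..U} (\<lambda>y. g (Complex (\<sigma>+U) y))) \<le> B * (2 * U)"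
        using side[of "-U" U "\<lambda>y. Complex (\<sigma>+U) y", OF _ cy] Upos \<sigma> far
        by (auto simp: norm_mult half_plane_def)
    qed
    finally have up: "cmod (integral {-U..U} (\<lambda>y. g (Complex \<sigma> y))) \<le> 4 * U * B"
      by (simp add: mult_ac)
    have "I \<le> integral {-U..U} (\<lambda>t. Re (g (Complex \<sigma> t)))"
      unfolding I_def using U \<sigma>
      by (intro integral_subset_le integrable_continuous_interval continuous_intros line)
        (auto simp: half_plane_def intro!: gpos)
    also have "\<dots> = Re (integral {-U..U} (\<lambda>t. g (Complex \<sigma> t)))"
      using integral_linear[OF integrable_continuous_interval[OF line] bounded_linear_Re, of "-U" U]
      by (simp add: o_def)
    also have "\<dots> \<le> 4 * U * B"
      using up complex_Re_le_cmod order_trans by blast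
    finally have "I \<le> 4 * U / (k * U - L)"
      by (simp add: B_def)
    then have "I * (k * U - L) \<le> 4 * U"
      using U by (simp add: pos_le_divide_eq)
    then show ?thesis
      using Upos by (simp add: field_simps)
  qed
  have "((\<lambda>U. I * (k - L / U)) \<longlongrightarrow> I * (k - 0)) at_top"
    by (intro tendsto_intros tendsto_divide_0[OF tendsto_const] filterlim_at_top_imp_at_infinity filterlim_ident)
  moreover have "\<forall>\<^sub>F U in at_top. I * (k - L / U) \<le> 4"
    using eventually_ge_at_top[of T] eventually_gt_at_top[of "L / k"]
    by eventually_elim (rule main, use k in \<open>auto simp: pos_divide_less_eq mult.commute\<close>)
  ultimately have "I * (k - 0) \<le> 4"
    by (intro tendsto_upperbound) auto
  then show ?thesis
    using k by (simp add: I_def g_def field_simps)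
next
  case False
  then have "{-T..T} \<subseteq> {0}" by auto
  then have "integral {-T..T} (\<lambda>t. Re (1 / (\<phi> (Complex \<sigma> t) + cnj z))) = 0"
    by (intro integral_unique has_integral_negligible[of "{0}"]) auto
  then show ?thesis using k by simp
qed

text \<open>
  On the square of half side \<open>Re w / 2\<close> about \<open>w\<close> the product \<open>Re z * Re (1 / (w + cnj z))\<close> is at least
  \<open>1 / 4\<close>.  Inserting it into the average over that square costs only a constant, and as the
  resulting integrand is nonnegative the square may be enlarged to a box that does not depend on \<open>w\<close>.  This makes the
  dependence on \<open>w\<close> smooth and ready for an exchange of integrals.
\<close>
lemma point_evaluation_le_kernel_integral:
  fixes f :: "complex \<Rightarrow> complex"
  assumes holo: "f holomorphic_on UNIV" and x: "Re w > 0"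
    and R: "3 * Re w \<le> 2 * R" and Y: "\<bar>Im w\<bar> + R \<le> Y"
  shows "(Re w)\<^sup>2 * (cmod (f w))\<^sup>2 \<le>
      16 * integral (cbox (0, -Y) (R, Y))
        (\<lambda>p. fst p * (cmod (f (Complex (fst p) (snd p))))\<^sup>2 *
             Re (1 / (w + cnj (Complex (fst p) (snd p)))))"
proof -
  define x v r where "x = Re w" and "v = Im w" and "r = Re w / 2"
  have w: "w = Complex x v" by (simp add: x_def v_def)
  have xr: "x = 2 * r" "r > 0" using x by (auto simp: x_def r_def)
  \<comment> \<open>The square reaches abscissa \<open>3 * r\<close>, so \<open>R\<close> has to be at least \<open>3 / 2\<close> times \<open>Re w\<close>.\<close>
  have R': "3 * r \<le> R" and Y': "\<bar>v\<bar> + R \<le> Y"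
    using R Y by (auto simp: v_def r_def)
  let ?S = "cbox (x - r, v - r) (x + r, v + r)"
  let ?B = "cbox (0, -Y) (R, Y)"
  define G where "G = (\<lambda>p. (cmod (f (Complex (fst p) (snd p))))\<^sup>2)"
  define H where "H = (\<lambda>p. fst p * G p * Re (1 / (w + cnj (Complex (fst p) (snd p)))))"
  have contf: "continuous_on UNIV f"
    using holo holomorphic_on_imp_continuous_on by blast
  have contG: "continuous_on A G" for A
    unfolding G_def by (intro continuous_intros continuous_on_compose2[OF contf]) auto
  have sub: "?S \<subseteq> ?B"
    using R' Y' xr by (auto simp: cbox_Pair_eq)
  have Repos: "Re (w + cnj (Complex (fst p) (snd p))) > 0" if "p \<in> ?B" for p
    using that x by (auto simp: cbox_Pair_eq)
  have nz: "w + cnj (Complex (fst p) (snd p)) \<noteq> 0" if "p \<in> ?B" for p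
    using Repos[OF that] by (metis less_irrefl zero_complex.sel(1))
  have contH: "continuous_on ?B H"
    unfolding H_def by (intro continuous_intros contG) (use nz in blast)
  have H0: "H p \<ge> 0" if "p \<in> ?B" for p
    unfolding H_def G_def using that Repos[OF that] by (auto simp: cbox_Pair_eq Re_divide)
  have GH: "G p \<le> 4 * H p" if "p \<in> ?S" for p
  proof -
    obtain q y where p: "p = (q, y)" by force
    from that have q: "r \<le> q" "q \<le> 3 * r" and y: "\<bar>v - y\<bar> \<le> r"
      using xr by (auto simp: p cbox_Pair_eq)
    define D where "D = (x + q)\<^sup>2 + (v - y)\<^sup>2"
    have "D > 0"
      unfolding D_def using q xr by (intro add_pos_nonneg) auto
    have "(v - y)\<^sup>2 \<le> r\<^sup>2"
      using y xr by (metis abs_le_square_iff abs_of_pos)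
    \<comment> \<open>With \<open>x = 2 * r\<close> the expanded product is the difference of \<open>4 * q * (x + q)\<close> and \<open>(x + q)\<^sup>2 + r\<^sup>2\<close>.\<close>
    moreover have "0 \<le> (q - r) * (3 * q + 7 * r) + 2 * r * r"
      using q xr by (intro add_nonneg_nonneg mult_nonneg_nonneg) auto
    ultimately have "D \<le> 4 * q * (x + q)"
      unfolding D_def xr by (simp add: power2_eq_square algebra_simps)
    moreover have "Re (1 / (w + cnj (Complex q y))) = (x + q) / D"
      by (simp add: w Re_divide D_def power2_eq_square)
    moreover have "4 * (q * ((x + q) / D)) = 4 * q * (x + q) / D"
      by simp
    ultimately have "1 \<le> 4 * (q * Re (1 / (w + cnj (Complex q y))))"
      using \<open>D > 0\<close> by (simp only: pos_le_divide_eq mult_1)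
    then have "G p * 1 \<le> G p * (4 * (q * Re (1 / (w + cnj (Complex q y)))))"
      by (intro mult_left_mono) (auto simp: G_def)
    then show ?thesis
      by (simp add: H_def p algebra_simps)
  qed
  have intH: "H integrable_on ?S" "H integrable_on ?B"
    using contH sub by (auto intro!: integrable_continuous intro: continuous_on_subset)
  have "r\<^sup>2 * (cmod (f w))\<^sup>2 \<le> integral ?S G"
    unfolding w G_def using xr by (intro norm_sq_le_square_average holo) auto
  also have "\<dots> \<le> integral ?S (\<lambda>p. 4 * H p)"
    by (intro integral_le integrable_continuous contG continuous_on_mult continuous_on_const
        continuous_on_subset[OF contH sub] GH)
  also have "\<dots> = 4 * integral ?S H"
    by simp
  also have "integral ?S H \<le> integral ?B H"
    using sub intH H0 by (intro integral_subset_le) auto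
  finally show ?thesis
    by (simp add: H_def G_def r_def power_divide)
qed

text \<open>
  Apply the pointwise bound at \<open>w = \<phi> (\<sigma> + i t)\<close>, integrate over \<open>t\<close> and exchange the integrals.  The
  inner integral over \<open>t\<close> is then bounded by \<open>4 / k\<close> for every \<open>z\<close>, uniformly in \<open>\<sigma>\<close> and \<open>T\<close>.
\<close>
lemma weighted_line_integral_le_area_integral:
  fixes f \<phi> :: "complex \<Rightarrow> complex"
  assumes fholo: "f holomorphic_on UNIV"
    and holo: "\<phi> holomorphic_on half_plane 0"
    and pos: "\<And>s. s \<in> half_plane 0 \<Longrightarrow> Re (\<phi> s) > 0"
    and near: "\<And>s. s \<in> half_plane 0 \<Longrightarrow> cmod (\<phi> s - of_real k * s) \<le> C"
    and k: "k > 0" and \<sigma>: "0 < \<sigma>" "\<sigma> \<le> 1" and T: "T > 0"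
    and R: "3 * (k + C) \<le> 2 * R" and Y: "k * T + C + R \<le> Y"
  shows "integral {-T..T} (\<lambda>t. (Re (\<phi> (Complex \<sigma> t)))\<^sup>2 * (cmod (f (\<phi> (Complex \<sigma> t))))\<^sup>2)
      \<le> 64 / k * integral (cbox (0, -Y) (R, Y))
          (\<lambda>p. fst p * (cmod (f (Complex (fst p) (snd p))))\<^sup>2)"
proof -
  define w where "w = (\<lambda>t. \<phi> (Complex \<sigma> t))"
  define G where "G = (\<lambda>p. fst p * (cmod (f (Complex (fst p) (snd p))))\<^sup>2)"
  define h where "h = (\<lambda>t p. Re (1 / (w t + cnj (Complex (fst p) (snd p)))))"
  let ?B = "cbox (0, -Y) (R, Y)"
  have line: "Complex \<sigma> t \<in> half_plane 0" for t
    using \<sigma> by (simp add: half_plane_def)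
  have contf: "continuous_on UNIV f"
    using fholo holomorphic_on_imp_continuous_on by blast
  have contw: "continuous_on A w" for A
    unfolding w_def
    by (intro continuous_on_compose2[OF holomorphic_on_imp_continuous_on[OF holo]] continuous_intros)
      (use line in auto)
  have contG: "continuous_on A G" for A
    unfolding G_def by (intro continuous_intros continuous_on_compose2[OF contf]) auto
  have wpos: "Re (w t) > 0" for t
    unfolding w_def by (intro pos line)
  have wnear: "Re (w t) \<le> k + C" "\<bar>Im (w t)\<bar> \<le> k * \<bar>t\<bar> + C" for t
  proof -
    have "cmod (w t - of_real k * Complex \<sigma> t) \<le> C"
      unfolding w_def by (intro near line)
    then have "\<bar>Re (w t) - k * \<sigma>\<bar> \<le> C" "\<bar>Im (w t) - k * t\<bar> \<le> C"
      using abs_Re_le_cmod[of "w t - of_real k * Complex \<sigma> t"]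
        abs_Im_le_cmod[of "w t - of_real k * Complex \<sigma> t"] by auto
    moreover have "k * \<sigma> \<le> k" "\<bar>k * t\<bar> = k * \<bar>t\<bar>"
      using k \<sigma> by (auto simp: mult_left_le abs_mult)
    ultimately show "Re (w t) \<le> k + C" "\<bar>Im (w t)\<bar> \<le> k * \<bar>t\<bar> + C"
      by linarith+
  qed
  have nz: "w t + cnj (Complex (fst p) (snd p)) \<noteq> 0" if "p \<in> ?B" for t p
  proof -
    have "Re (w t + cnj (Complex (fst p) (snd p))) > 0"
      using that wpos[of t] by (auto simp: cbox_Pair_eq)
    then show ?thesis by fastforce
  qed
  have conth: "continuous_on A (\<lambda>q. h (a q) (b q))"
    if "continuous_on A a" "continuous_on A b" "b ` A \<subseteq> ?B" for A :: "'t::topological_space set" and a b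
    unfolding h_def using that
    by (intro continuous_intros continuous_on_compose2[OF contw that(1)]) (use nz in blast)+
  have contF: "continuous_on (cbox (-T, (0, -Y)) (T, (R, Y))) (\<lambda>(t, p). G p * h t p)"
    unfolding case_prod_beta
    by (intro continuous_intros continuous_on_compose2[OF contG] conth)
      (auto simp: cbox_Pair_eq)
  have point: "(Re (w t))\<^sup>2 * (cmod (f (w t)))\<^sup>2 \<le> 16 * integral ?B (\<lambda>p. G p * h t p)"
    if "t \<in> cbox (-T) T" for t
  proof -
    have "k * \<bar>t\<bar> \<le> k * T"
      using that k by (intro mult_left_mono) auto
    then have "3 * Re (w t) \<le> 2 * R" "\<bar>Im (w t)\<bar> + R \<le> Y"
      using wnear[of t] R Y by (simp_all add: distrib_left)
    then show ?thesis
      unfolding G_def h_def by (intro point_evaluation_le_kernel_integral fholo wpos)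
  qed
  have "integral (cbox (-T) T) (\<lambda>t. (Re (w t))\<^sup>2 * (cmod (f (w t)))\<^sup>2)
      \<le> integral (cbox (-T) T) (\<lambda>t. 16 * integral ?B (\<lambda>p. G p * h t p))"
  proof (intro integral_le integrable_continuous point)
    show "continuous_on (cbox (-T) T) (\<lambda>t. (Re (w t))\<^sup>2 * (cmod (f (w t)))\<^sup>2)"
      by (intro continuous_intros contw continuous_on_compose2[OF contf contw]) auto
    have "continuous_on (cbox (-T) T) (\<lambda>t. integral ?B (\<lambda>p. G p * h t p))"
      by (rule integral_continuous_on_param[OF contF[unfolded cbox_Pair_eq[of "-T" _ T]]])
    then show "continuous_on (cbox (-T) T) (\<lambda>t. 16 * integral ?B (\<lambda>p. G p * h t p))"
      by (intro continuous_intros)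
  qed
  also have "\<dots> = 16 * integral (cbox (-T) T) (\<lambda>t. integral ?B (\<lambda>p. G p * h t p))"
    by simp
  also have "integral (cbox (-T) T) (\<lambda>t. integral ?B (\<lambda>p. G p * h t p)) =
      integral ?B (\<lambda>p. integral (cbox (-T) T) (\<lambda>t. G p * h t p))"
    using integral_swap_continuous[OF contF] by simp
  also have "\<dots> = integral ?B (\<lambda>p. G p * integral (cbox (-T) T) (\<lambda>t. h t p))"
    by simp
  also have "\<dots> \<le> integral ?B (\<lambda>p. G p * (4 / k))"
  proof (intro integral_le integrable_continuous)
    have "continuous_on ?B (\<lambda>p. integral (cbox (-T) T) (\<lambda>t. h t p))"
      by (rule integral_continuous_on_param, unfold case_prod_beta) (intro conth continuous_intros, auto)
    then show "continuous_on ?B (\<lambda>p. G p * integral (cbox (-T) T) (\<lambda>t. h t p))"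
      by (intro continuous_intros contG)
    show "continuous_on ?B (\<lambda>p. G p * (4 / k))"
      using k by (intro continuous_intros contG) auto
    show "G p * integral (cbox (-T) T) (\<lambda>t. h t p) \<le> G p * (4 / k)" if "p \<in> ?B" for p
    proof (rule mult_left_mono)
      show "integral (cbox (-T) T) (\<lambda>t. h t p) \<le> 4 / k"
        unfolding h_def w_def interval_cbox[symmetric]
        by (rule kernel_line_integral_le[OF holo pos near k \<sigma>(1)])
          (use that in \<open>auto simp: cbox_Pair_eq\<close>)
      show "0 \<le> G p"
        using that by (auto simp: G_def cbox_Pair_eq)
    qed
  qed
  also have "\<dots> = integral ?B G * (4 / k)"
    by simp
  finally show ?thesis
    by (simp add: w_def G_def mult_ac)
qed

section \<open>Means of Dirichlet polynomials\<close>

lemma norm_nat_powr: "cmod (of_nat (Suc n) powr s) = real (Suc n) powr Re s"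
  by (subst norm_powr_real_powr) (auto simp del: of_nat_Suc)

lemma norm_dirichlet_term:
  "cmod (dirichlet_term a s n) = cmod (a (Suc n)) * real (Suc n) powr (- Re s)"
  by (simp only: dirichlet_term_def norm_mult norm_nat_powr uminus_complex.sel)

lemma continuous_on_nat_powr [continuous_intros]:
  "continuous_on A f \<Longrightarrow> continuous_on A (\<lambda>x. of_nat (Suc n) powr (f x :: complex))"
  by (intro continuous_on_powr_complex) (auto simp del: of_nat_Suc)

lemma holomorphic_dirichlet_term: "(\<lambda>s. dirichlet_term a s n) holomorphic_on A"
  unfolding dirichlet_term_def by (intro holomorphic_intros)

lemma continuous_on_dirichlet_term [continuous_intros]:
  "continuous_on A f \<Longrightarrow> continuous_on A (\<lambda>x. dirichlet_term a (f x) n)"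
  unfolding dirichlet_term_def by (intro continuous_intros)

text \<open>
  The function \<open>((n + 1) / (k + 1)) powr (\<i> * t)\<close>.
\<close>
definition oscillation :: "nat \<Rightarrow> nat \<Rightarrow> real \<Rightarrow> complex" where
  "oscillation n k t = exp (\<i> * of_real ((ln (real (Suc n)) - ln (real (Suc k))) * t))"

lemma continuous_on_oscillation [continuous_intros]:
  "continuous_on A f \<Longrightarrow> continuous_on A (\<lambda>x. oscillation n k (f x))"
  unfolding oscillation_def by (intro continuous_intros)

lemma nat_powr_Complex:
  "of_nat (Suc n) powr Complex x y =
     of_real (real (Suc n) powr x) * exp (\<i> * of_real (ln (real (Suc n)) * y))"
proof -
  have "of_nat (Suc n) powr Complex x y = exp (Complex x y * of_real (ln (real (Suc n))))"
    by (simp add: powr_def Ln_of_nat del: of_nat_Suc)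
  also have "Complex x y * of_real (ln (real (Suc n))) =
      of_real (x * ln (real (Suc n))) + \<i> * of_real (ln (real (Suc n)) * y)"
    by (simp add: complex_eq_iff)
  finally show ?thesis
    by (simp add: exp_add powr_def exp_of_real del: of_nat_Suc of_real_mult)
qed

lemma nat_powr_times_oscillation:
  "of_nat (Suc k) powr (- Complex x y) * of_nat (Suc n) powr Complex x' y =
     of_real (real (Suc k) powr (-x) * real (Suc n) powr x') * oscillation n k y"
proof -
  have "- Complex x y = Complex (-x) (-y)"
    by (simp add: complex_eq_iff)
  then show ?thesis
    unfolding oscillation_def \<open>- Complex x y = _\<close> nat_powr_Complex
    by (simp add: left_diff_distrib right_diff_distrib exp_diff exp_minus field_simps del: of_nat_Suc)
qed

lemma norm_integral_oscillation_le:
  assumes "n \<noteq> k" "T \<ge> 0"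
  shows "cmod (integral {-T..T} (oscillation n k)) \<le> 2 / \<bar>ln (real (Suc n)) - ln (real (Suc k))\<bar>"
proof -
  define l where "l = ln (real (Suc n)) - ln (real (Suc k))"
  have l: "l \<noteq> 0"
    using assms(1) by (simp add: l_def del: of_nat_Suc)
  define G where "G = (\<lambda>t. exp (\<i> * of_real (l * t)) / (\<i> * of_real l))"
  have "((\<lambda>t. exp (\<i> * of_real (l * t))) has_integral (G T - G (-T))) {-T..T}"
    unfolding G_def using assms(2) l
    by (intro fundamental_theorem_of_calculus)
      (auto intro!: derivative_eq_intros has_vector_derivative_real_field simp: field_simps)
  then have "integral {-T..T} (oscillation n k) = G T - G (-T)"
    by (simp add: oscillation_def[abs_def] l_def integral_unique)
  also have "cmod \<dots> \<le> cmod (G T) + cmod (G (-T))"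
    by (rule norm_triangle_ineq4)
  also have "\<dots> = 2 / \<bar>l\<bar>"
    unfolding G_def norm_divide norm_mult by (simp flip: of_real_minus of_real_mult)
  finally show ?thesis by (simp add: l_def)
qed

lemma oscillation_same [simp]: "oscillation n n t = 1"
  by (simp add: oscillation_def)

text \<open>
  For a Dirichlet polynomial \<open>F\<close> this mean tends to the coefficient of \<open>(n + 1) powr (-s)\<close> as \<open>T\<close> grows.
\<close>
definition coeff_mean :: "(complex \<Rightarrow> complex) \<Rightarrow> real \<Rightarrow> nat \<Rightarrow> real \<Rightarrow> complex" where
  "coeff_mean F \<sigma> n T =
     integral {-T..T} (\<lambda>t. F (Complex \<sigma> t) * of_nat (Suc n) powr Complex \<sigma> t) / of_real (2 * T)"

lemma tendsto_mean_oscillation: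
  "((\<lambda>T. integral {-T..T} (oscillation n k) / of_real (2 * T)) \<longlongrightarrow> (if n = k then 1 else 0)) at_top"
proof (cases "n = k")
  case True
  have "\<forall>\<^sub>F T in at_top. integral {-T..T} (oscillation n k) / of_real (2 * T) = 1"
    using eventually_gt_at_top[of 0]
    by eventually_elim (simp add: True oscillation_def[abs_def] scaleR_conv_of_real)
  then show ?thesis using True by (simp add: tendsto_eventually)
next
  case False
  define D where "D = 2 / \<bar>ln (real (Suc n)) - ln (real (Suc k))\<bar>"
  have "((\<lambda>T. D / (2 * T)) \<longlongrightarrow> 0) at_top"
    by (intro tendsto_divide_0[OF tendsto_const] filterlim_at_top_imp_at_infinity
        filterlim_tendsto_pos_mult_at_top[OF tendsto_const] filterlim_ident) auto
  moreover have "\<forall>\<^sub>F T in at_top. norm (integral {-T..T} (oscillation n k) / of_real (2 * T)) \<le> D / (2 * T)"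
    using eventually_gt_at_top[of 0]
    by eventually_elim
      (use norm_integral_oscillation_le[OF False, folded D_def] in \<open>simp add: norm_divide divide_right_mono\<close>)
  ultimately show ?thesis
    using False by (auto intro: Lim_null_comparison)
qed

lemma coeff_mean_sum:
  assumes "\<And>i. i \<in> A \<Longrightarrow> continuous_on {-T..T} (\<lambda>t. F i (Complex \<sigma> t))"
  shows "coeff_mean (\<lambda>s. \<Sum>i\<in>A. c i * F i s) \<sigma> n T = (\<Sum>i\<in>A. c i * coeff_mean (F i) \<sigma> n T)"
proof (cases "finite A")
  case True
  have "integral {-T..T} (\<lambda>t. (\<Sum>i\<in>A. c i * F i (Complex \<sigma> t)) * of_nat (Suc n) powr Complex \<sigma> t) =
      integral {-T..T} (\<lambda>t. \<Sum>i\<in>A. c i * (F i (Complex \<sigma> t) * of_nat (Suc n) powr Complex \<sigma> t))"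
    by (simp add: sum_distrib_right mult.assoc)
  also have "\<dots> = (\<Sum>i\<in>A. integral {-T..T} (\<lambda>t. c i * (F i (Complex \<sigma> t) * of_nat (Suc n) powr Complex \<sigma> t)))"
    by (intro integral_sum True integrable_continuous_interval continuous_intros assms)
  finally show ?thesis
    by (simp add: coeff_mean_def sum_divide_distrib)
qed (simp add: coeff_mean_def)

lemma coeff_mean_dirichlet_polynomial:
  "((\<lambda>T. coeff_mean (\<lambda>s. \<Sum>k<N. dirichlet_term p s k) \<sigma> n T) \<longlongrightarrow> (if n < N then p (Suc n) else 0)) at_top"
proof -
  define c where "c = (\<lambda>k. p (Suc k) * of_real (real (Suc k) powr (-\<sigma>) * real (Suc n) powr \<sigma>))"
  have "coeff_mean (\<lambda>s. of_nat (Suc k) powr (-s)) \<sigma> n T =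
      of_real (real (Suc k) powr (-\<sigma>) * real (Suc n) powr \<sigma>) * (integral {-T..T} (oscillation n k) / of_real (2*T))" for k T
    unfolding coeff_mean_def nat_powr_times_oscillation by simp
  then have eq: "coeff_mean (\<lambda>s. \<Sum>k<N. dirichlet_term p s k) \<sigma> n T =
      (\<Sum>k<N. c k * (integral {-T..T} (oscillation n k) / of_real (2*T)))" for T
    unfolding dirichlet_term_def
    by (subst coeff_mean_sum) (auto intro!: continuous_intros simp: c_def mult.assoc simp del: of_nat_Suc)
  have "((\<lambda>T. coeff_mean (\<lambda>s. \<Sum>k<N. dirichlet_term p s k) \<sigma> n T)
      \<longlongrightarrow> (\<Sum>k<N. c k * (if n = k then 1 else 0))) at_top"
    unfolding eq by (intro tendsto_intros tendsto_mean_oscillation)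
  also have "(\<Sum>k<N. c k * (if n = k then 1 else 0)) = (\<Sum>k<N. if n = k then p (Suc n) else 0)"
  proof (intro sum.cong refl)
    have "real (Suc j) powr (-\<sigma>) * real (Suc j) powr \<sigma> = 1" for j
      by (simp flip: powr_add del: of_nat_Suc)
    then show "c k * (if n = k then 1 else 0) = (if n = k then p (Suc n) else 0)" for k
      by (simp add: c_def del: of_nat_Suc of_real_mult)
  qed
  also have "\<dots> = (if n < N then p (Suc n) else 0)"
    by simp
  finally show ?thesis .
qed

text \<open>
  The off-diagonal terms of the expanded square have bounded integrals over \<open>{-Y..Y}\<close>.  That \<open>E\<close> is
  independent of \<open>x\<close> lets the estimate be integrated over \<open>x\<close> afterwards.
\<close>
lemma mean_square_dirichlet_polynomial_le:
  obtains E where "\<And>x Y. x \<ge> 0 \<Longrightarrow> Y \<ge> 0 \<Longrightarrow>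
    integral {-Y..Y} (\<lambda>y. (cmod (\<Sum>k<N. dirichlet_term a (Complex x y) k))\<^sup>2) \<le>
      2 * Y * (\<Sum>k<N. (cmod (a (Suc k)))\<^sup>2 * real (Suc k) powr (-2 * x)) + E"
proof
  define E where "E = (\<Sum>k<N. \<Sum>n<N. if n = k then 0 else
    cmod (a (Suc k)) * cmod (a (Suc n)) * (2 / \<bar>ln (real (Suc n)) - ln (real (Suc k))\<bar>))"
  fix x Y :: real
  assume x: "x \<ge> 0" and Y: "Y \<ge> 0"
  define w where "w = (\<lambda>k n. real (Suc k) powr (-x) * real (Suc n) powr (-x))"
  define c where "c = (\<lambda>k n. a (Suc k) * cnj (a (Suc n)) * of_real (w k n))"
  let ?f = "\<lambda>y. \<Sum>k<N. dirichlet_term a (Complex x y) k"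
  have prods: "dirichlet_term a (Complex x y) k * cnj (dirichlet_term a (Complex x y) n) =
      c k n * oscillation n k y" for k n y
  proof -
    have "cnj (of_nat (Suc n) powr (- Complex x y)) = of_nat (Suc n) powr Complex (-x) y"
    proof -
      have "- Complex x y = Complex (-x) (-y)" by (simp add: complex_eq_iff)
      then show ?thesis
        by (simp add: nat_powr_Complex exp_cnj del: of_nat_Suc)
    qed
    then have "dirichlet_term a (Complex x y) k * cnj (dirichlet_term a (Complex x y) n) =
      a (Suc k) * cnj (a (Suc n)) *
      (of_nat (Suc k) powr (- Complex x y) * of_nat (Suc n) powr Complex (-x) y)"
      unfolding dirichlet_term_def complex_cnj_mult by (simp only: mult_ac)
    then show ?thesis
      unfolding nat_powr_times_oscillation c_def w_def by (simp only: mult_ac)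
  qed
  have sq: "of_real ((cmod (?f y))\<^sup>2) = (\<Sum>k<N. \<Sum>n<N. c k n * oscillation n k y)" for y
    unfolding complex_norm_square cnj_sum sum_product prods ..
  have cont: "continuous_on A ?f" for A
    by (intro continuous_intros)
  have "complex_of_real (integral {-Y..Y} (\<lambda>y. (cmod (?f y))\<^sup>2)) =
      integral {-Y..Y} (\<lambda>y. of_real ((cmod (?f y))\<^sup>2))"
    using integral_linear[OF integrable_continuous_interval bounded_linear_of_real[where 'a = complex], of "-Y" Y "\<lambda>y. (cmod (?f y))\<^sup>2"]
    by (simp add: o_def continuous_intros cont)
  also have "\<dots> = (\<Sum>k<N. \<Sum>n<N. c k n * integral {-Y..Y} (oscillation n k))"
    unfolding sq
    by (subst integral_sum, simp, intro integrable_continuous_interval continuous_intros, intro sum.cong refl,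
        subst integral_sum, simp, intro integrable_continuous_interval continuous_intros, simp)
  finally have "integral {-Y..Y} (\<lambda>y. (cmod (?f y))\<^sup>2) =
     Re (\<Sum>k<N. \<Sum>n<N. c k n * integral {-Y..Y} (oscillation n k))"
    by (metis Re_complex_of_real)
  also have "\<dots> = (\<Sum>k<N. \<Sum>n<N. Re (c k n * integral {-Y..Y} (oscillation n k)))"
    by simp
  also have "\<dots> \<le> (\<Sum>k<N. \<Sum>n<N. (if n = k then 2 * Y * ((cmod (a (Suc k)))\<^sup>2 * real (Suc k) powr (-2 * x)) else 0) +
      (if n = k then 0 else cmod (a (Suc k)) * cmod (a (Suc n)) * (2 / \<bar>ln (real (Suc n)) - ln (real (Suc k))\<bar>)))"
  proof (intro sum_mono)
    fix k n
    show "Re (c k n * integral {-Y..Y} (oscillation n k)) \<le>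
      (if n = k then 2 * Y * ((cmod (a (Suc k)))\<^sup>2 * real (Suc k) powr (-2 * x)) else 0) +
      (if n = k then 0 else cmod (a (Suc k)) * cmod (a (Suc n)) * (2 / \<bar>ln (real (Suc n)) - ln (real (Suc k))\<bar>))"
    proof (cases "n = k")
      case True
      have "a (Suc k) * cnj (a (Suc k)) = of_real ((cmod (a (Suc k)))\<^sup>2)"
        by (simp only: complex_norm_square)
      moreover have "w k k = real (Suc k) powr (-2 * x)"
        unfolding w_def by (simp flip: powr_add del: of_nat_Suc)
      ultimately have "c k k = of_real ((cmod (a (Suc k)))\<^sup>2 * real (Suc k) powr (-2 * x))"
        by (simp add: c_def del: of_nat_Suc)
      moreover have "integral {-Y..Y} (oscillation k k) = of_real (2 * Y)"
        using Y by (simp add: oscillation_def[abs_def] scaleR_conv_of_real)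
      ultimately show ?thesis
        using True by (simp flip: of_real_mult del: of_nat_Suc)
    next
      case False
      have "Re (c k n * integral {-Y..Y} (oscillation n k)) \<le> cmod (c k n) * cmod (integral {-Y..Y} (oscillation n k))"
        using complex_Re_le_cmod norm_mult by metis
      also have "\<dots> \<le> (cmod (a (Suc k)) * cmod (a (Suc n))) * (2 / \<bar>ln (real (Suc n)) - ln (real (Suc k))\<bar>)"
      proof (intro mult_mono norm_integral_oscillation_le False Y)
        have "real (Suc k) powr (-x) \<le> 1" "real (Suc n) powr (-x) \<le> 1"
          using x powr_mono[of "-x" 0 "real (Suc k)"] powr_mono[of "-x" 0 "real (Suc n)"] by auto
        then have "w k n \<le> 1" "w k n \<ge> 0"
          unfolding w_def by (auto intro: mult_le_one simp del: of_nat_Suc)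
        then show "cmod (c k n) \<le> cmod (a (Suc k)) * cmod (a (Suc n))"
          unfolding c_def norm_mult by (simp add: mult_left_le)
      qed auto
      finally show ?thesis using False by simp
    qed
  qed
  also have "\<dots> = 2 * Y * (\<Sum>k<N. (cmod (a (Suc k)))\<^sup>2 * real (Suc k) powr (-2 * x)) + E"
    unfolding sum.distrib E_def by (simp add: sum_distrib_left del: of_nat_Suc)
  finally show "integral {-Y..Y} (\<lambda>y. (cmod (?f y))\<^sup>2) \<le>
      2 * Y * (\<Sum>k<N. (cmod (a (Suc k)))\<^sup>2 * real (Suc k) powr (-2 * x)) + E" .
qed

section \<open>The mean square of the image on a vertical line\<close>

text \<open>
  The squared norm of \<open>(n + 1) powr (-s)\<close> in the space \<open>A_space\<close>.
\<close>
definition A_weight :: "nat \<Rightarrow> real" where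
  "A_weight n = integral {0..1} (\<lambda>\<sigma>. \<sigma> * real (Suc n) powr (-2 * \<sigma>))"

lemma continuous_on_real_nat_powr [continuous_intros]:
  fixes f :: "'a::topological_space \<Rightarrow> real"
  shows "continuous_on A f \<Longrightarrow> continuous_on A (\<lambda>x. real (Suc n) powr (f x))"
  by (intro continuous_intros) (auto simp del: of_nat_Suc)

text \<open>
  After the substitution \<open>x = R * \<sigma>\<close> this is the monotonicity of \<open>y \<mapsto> (n + 1) powr (-2 * y)\<close>.
\<close>
lemma weight_integral_le:
  assumes R: "R \<ge> 1"
  shows "integral {0..R} (\<lambda>x. x * real (Suc n) powr (-2 * x)) \<le> R\<^sup>2 * A_weight n"
proof -
  let ?f = "\<lambda>x. x * real (Suc n) powr (-2 * x)"
  have img: "(\<lambda>x. x / R) ` {0..R} = {0..1}"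
    using R image_divide_atLeastAtMost[of R 0 R] by simp
  have "integral {0..1} (\<lambda>x. ?f (R * x)) = (1 / \<bar>R\<bar>) *\<^sub>R integral {0..R} ?f"
    using R integral_stretch_real[of R 0 R ?f] unfolding img by simp
  then have "integral {0..R} ?f = R * integral {0..1} (\<lambda>x. ?f (R * x))"
    using R by (simp add: nonzero_eq_divide_eq mult.commute)
  also have "integral {0..1} (\<lambda>x. ?f (R * x)) \<le> integral {0..1} (\<lambda>x. R * ?f x)"
  proof (intro integral_le integrable_continuous_interval continuous_intros)
    fix x :: real assume x: "x \<in> {0..1}"
    have "1 * x \<le> R * x"
      using x R by (intro mult_right_mono) auto
    then have "real (Suc n) powr (-2 * (R * x)) \<le> real (Suc n) powr (-2 * x)"
      by (intro powr_mono) auto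
    then have "R * x * real (Suc n) powr (-2 * (R * x)) \<le> R * x * real (Suc n) powr (-2 * x)"
      using x R by (intro mult_left_mono) auto
    then show "?f (R * x) \<le> R * ?f x"
      by (simp only: mult.assoc)
  qed (simp_all del: of_nat_Suc)
  also have "integral {0..1} (\<lambda>x. R * ?f x) = R * A_weight n"
    unfolding A_weight_def by (rule integral_mult_right)
  finally show ?thesis
    using R by (simp add: power2_eq_square)
qed

lemma area_integral_dirichlet_polynomial_le:
  assumes R: "R \<ge> 1"
  obtains E where "\<And>Y. Y \<ge> 0 \<Longrightarrow>
    integral (cbox (0, -Y) (R, Y))
      (\<lambda>p. fst p * (cmod (\<Sum>k<N. dirichlet_term a (Complex (fst p) (snd p)) k))\<^sup>2)
    \<le> 2 * Y * (R\<^sup>2 * (\<Sum>k<N. A_weight k * (cmod (a (Suc k)))\<^sup>2)) + E"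
proof -
  obtain E where E: "\<And>x Y. x \<ge> 0 \<Longrightarrow> Y \<ge> 0 \<Longrightarrow>
    integral {-Y..Y} (\<lambda>y. (cmod (\<Sum>k<N. dirichlet_term a (Complex x y) k))\<^sup>2) \<le>
      2 * Y * (\<Sum>k<N. (cmod (a (Suc k)))\<^sup>2 * real (Suc k) powr (-2 * x)) + E"
    using mean_square_dirichlet_polynomial_le by blast
  let ?g = "\<lambda>x y. (cmod (\<Sum>k<N. dirichlet_term a (Complex x y) k))\<^sup>2"
  let ?s = "\<lambda>x. \<Sum>k<N. (cmod (a (Suc k)))\<^sup>2 * (x * real (Suc k) powr (-2 * x))"
  have "integral (cbox (0, -Y) (R, Y)) (\<lambda>p. fst p * ?g (fst p) (snd p))
      \<le> 2 * Y * (R\<^sup>2 * (\<Sum>k<N. A_weight k * (cmod (a (Suc k)))\<^sup>2)) + integral {0..R} (\<lambda>x. x * E)"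
    if Y: "Y \<ge> 0" for Y
  proof -
    have cont: "continuous_on (cbox (0, -Y) (R, Y)) (\<lambda>p. fst p * ?g (fst p) (snd p))"
      by (intro continuous_intros)
    have "integral (cbox (0, -Y) (R, Y)) (\<lambda>p. fst p * ?g (fst p) (snd p)) =
        integral {0..R} (\<lambda>x. integral {-Y..Y} (\<lambda>y. x * ?g x y))"
      using integral_prod_continuous[OF cont] by simp
    also have "\<dots> \<le> integral {0..R} (\<lambda>x. 2 * Y * ?s x + x * E)"
    proof (rule integral_le)
      have "continuous_on (cbox 0 R) (\<lambda>x. integral (cbox (-Y) Y) (\<lambda>y. x * ?g x y))"
        by (rule integral_continuous_on_param, unfold case_prod_beta) (intro continuous_intros)
      then show "(\<lambda>x. integral {-Y..Y} (\<lambda>y. x * ?g x y)) integrable_on {0..R}"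
        by (intro integrable_continuous_interval) simp
      show "(\<lambda>x. 2 * Y * ?s x + x * E) integrable_on {0..R}"
        by (intro integrable_continuous_interval continuous_intros)
      show "integral {-Y..Y} (\<lambda>y. x * ?g x y) \<le> 2 * Y * ?s x + x * E" if "x \<in> {0..R}" for x
      proof -
        have "integral {-Y..Y} (\<lambda>y. x * ?g x y) = x * integral {-Y..Y} (?g x)"
          by simp
        also have "\<dots> \<le> x * (2 * Y * (\<Sum>k<N. (cmod (a (Suc k)))\<^sup>2 * real (Suc k) powr (-2 * x)) + E)"
          using that Y by (intro mult_left_mono E) auto
        also have "\<dots> = 2 * Y * ?s x + x * E"
          by (simp add: sum_distrib_left distrib_left mult_ac del: of_nat_Suc)
        finally show ?thesis .
      qed
    qed
    also have "\<dots> = 2 * Y * integral {0..R} ?s + integral {0..R} (\<lambda>x. x * E)"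
    proof -
      have "integral {0..R} (\<lambda>x. 2 * Y * ?s x + x * E) =
          integral {0..R} (\<lambda>x. 2 * Y * ?s x) + integral {0..R} (\<lambda>x. x * E)"
        by (intro integral_add integrable_continuous_interval continuous_intros)
      then show ?thesis by (simp only: integral_mult_right)
    qed
    also have "integral {0..R} ?s =
        (\<Sum>k<N. (cmod (a (Suc k)))\<^sup>2 * integral {0..R} (\<lambda>x. x * real (Suc k) powr (-2 * x)))"
      by (subst integral_sum) (auto intro!: integrable_continuous_interval continuous_intros simp del: of_nat_Suc)
    also have "\<dots> \<le> (\<Sum>k<N. (cmod (a (Suc k)))\<^sup>2 * (R\<^sup>2 * A_weight k))"
      by (intro sum_mono mult_left_mono weight_integral_le R) auto
    also have "\<dots> = R\<^sup>2 * (\<Sum>k<N. A_weight k * (cmod (a (Suc k)))\<^sup>2)"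
      by (simp add: sum_distrib_left mult_ac)
    finally show ?thesis
      using Y by (simp add: mult_left_mono)
  qed
  then show ?thesis by (rule that)
qed

text \<open>
  The box in the area estimate has height about \<open>2 * k * T\<close>, since \<open>\<phi>\<close> stretches vertical lines by
  the factor \<open>k\<close>.  This cancels the factor \<open>1 / k\<close> from the kernel.
\<close>
lemma mean_square_weighted_composition_le:
  fixes u \<phi> :: "complex \<Rightarrow> complex"
  assumes holo: "\<phi> holomorphic_on half_plane 0"
    and pos: "\<And>s. s \<in> half_plane 0 \<Longrightarrow> Re (\<phi> s) > 0"
    and near: "\<And>s. s \<in> half_plane 0 \<Longrightarrow> cmod (\<phi> s - of_real k * s) \<le> C"
    and ucont: "continuous_on (half_plane 0) u"
    and ule: "\<And>s. s \<in> half_plane 0 \<Longrightarrow> cmod (u s) \<le> D * Re (\<phi> s)"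
    and k: "k \<ge> 1" and C: "C \<ge> 0" and D: "D \<ge> 0" and \<sigma>: "0 < \<sigma>" "\<sigma> \<le> 1"
    and F: "F = (\<lambda>s. u s * (\<Sum>n<N. dirichlet_term a (\<phi> s) n))"
  obtains B where
    "(B \<longlongrightarrow> 144 * D\<^sup>2 * (k + C)\<^sup>2 * (\<Sum>n<N. A_weight n * (cmod (a (Suc n)))\<^sup>2)) at_top"
    "\<And>T. T > 0 \<Longrightarrow> integral {-T..T} (\<lambda>t. (cmod (F (Complex \<sigma> t)))\<^sup>2) / (2 * T) \<le> B T"
proof -
  define f where "f = (\<lambda>s. \<Sum>n<N. dirichlet_term a s n)"
  define R where "R = 3 / 2 * (k + C)"
  define S where "S = (\<Sum>n<N. A_weight n * (cmod (a (Suc n)))\<^sup>2)"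
  have R: "R \<ge> 1" using k C by (simp add: R_def)
  obtain E where E: "\<And>Y. Y \<ge> 0 \<Longrightarrow>
    integral (cbox (0, -Y) (R, Y)) (\<lambda>p. fst p * (cmod (f (Complex (fst p) (snd p))))\<^sup>2)
    \<le> 2 * Y * (R\<^sup>2 * S) + E"
    unfolding f_def S_def using area_integral_dirichlet_polynomial_le[OF R] by blast
  define B where "B = (\<lambda>T. D\<^sup>2 * (64 / k) * (k * (R\<^sup>2 * S) + ((C + R) * (R\<^sup>2 * S) + E / 2) / T))"
  have F': "F s = u s * f (\<phi> s)" for s
    by (simp add: F f_def)
  have fholo: "f holomorphic_on UNIV"
    unfolding f_def by (intro holomorphic_intros holomorphic_dirichlet_term)
  have line: "Complex \<sigma> t \<in> half_plane 0" for t
    using \<sigma> by (simp add: half_plane_def)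
  have contL: "continuous_on A (\<lambda>t. g (Complex \<sigma> t))" if "continuous_on (half_plane 0) g" for A and g :: "complex \<Rightarrow> complex"
    by (intro continuous_on_compose2[OF that] continuous_intros) (use line in auto)
  note contphi = contL[OF holomorphic_on_imp_continuous_on[OF holo]]
  have contf: "continuous_on A (\<lambda>t. f (\<phi> (Complex \<sigma> t)))" for A
    using holomorphic_on_imp_continuous_on[OF fholo] contphi continuous_on_compose2 by blast
  show ?thesis
  proof
    have "(B \<longlongrightarrow> D\<^sup>2 * (64 / k) * (k * (R\<^sup>2 * S) + 0)) at_top"
      unfolding B_def
      by (intro tendsto_intros tendsto_divide_0[OF tendsto_const] filterlim_at_top_imp_at_infinity filterlim_ident)
    also have "D\<^sup>2 * (64 / k) * (k * (R\<^sup>2 * S) + 0) = 144 * D\<^sup>2 * (k + C)\<^sup>2 * S"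
    proof -
      have "R\<^sup>2 = 9 / 4 * (k + C)\<^sup>2"
        unfolding R_def power_mult_distrib by (simp add: power_divide)
      then show ?thesis using k by simp
    qed
    finally show "(B \<longlongrightarrow> 144 * D\<^sup>2 * (k + C)\<^sup>2 * (\<Sum>n<N. A_weight n * (cmod (a (Suc n)))\<^sup>2)) at_top"
      by (simp add: S_def)
  next
    fix T :: real assume T: "T > 0"
    define Y where "Y = k * T + C + R"
    have Y: "Y \<ge> 0" using T k C R by (simp add: Y_def)
    let ?I = "integral {-T..T} (\<lambda>t. (Re (\<phi> (Complex \<sigma> t)))\<^sup>2 * (cmod (f (\<phi> (Complex \<sigma> t))))\<^sup>2)"
    have "integral {-T..T} (\<lambda>t. (cmod (F (Complex \<sigma> t)))\<^sup>2) \<le>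
        integral {-T..T} (\<lambda>t. D\<^sup>2 * ((Re (\<phi> (Complex \<sigma> t)))\<^sup>2 * (cmod (f (\<phi> (Complex \<sigma> t))))\<^sup>2))"
    proof (intro integral_le integrable_continuous_interval)
      show "continuous_on {-T..T} (\<lambda>t. (cmod (F (Complex \<sigma> t)))\<^sup>2)"
        unfolding F' by (intro continuous_intros contf contL ucont)
      show "continuous_on {-T..T} (\<lambda>t. D\<^sup>2 * ((Re (\<phi> (Complex \<sigma> t)))\<^sup>2 * (cmod (f (\<phi> (Complex \<sigma> t))))\<^sup>2))"
        by (intro continuous_intros contf contphi)
      fix t
      have "(cmod (u (Complex \<sigma> t)))\<^sup>2 \<le> (D * Re (\<phi> (Complex \<sigma> t)))\<^sup>2"
        by (intro power_mono ule line) auto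
      then have "(cmod (u (Complex \<sigma> t)))\<^sup>2 * (cmod (f (\<phi> (Complex \<sigma> t))))\<^sup>2 \<le>
          (D * Re (\<phi> (Complex \<sigma> t)))\<^sup>2 * (cmod (f (\<phi> (Complex \<sigma> t))))\<^sup>2"
        by (intro mult_right_mono) auto
      then show "(cmod (F (Complex \<sigma> t)))\<^sup>2 \<le> D\<^sup>2 * ((Re (\<phi> (Complex \<sigma> t)))\<^sup>2 * (cmod (f (\<phi> (Complex \<sigma> t))))\<^sup>2)"
        by (simp add: F' norm_mult power_mult_distrib mult_ac)
    qed
    also have "\<dots> = D\<^sup>2 * ?I"
      by simp
    also have "?I \<le> 64 / k * integral (cbox (0, -Y) (R, Y))
        (\<lambda>p. fst p * (cmod (f (Complex (fst p) (snd p))))\<^sup>2)"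
      using k by (intro weighted_line_integral_le_area_integral fholo holo pos near \<sigma> T)
        (auto simp: R_def Y_def intro: near)
    also have "\<dots> \<le> 64 / k * (2 * Y * (R\<^sup>2 * S) + E)"
      using k by (intro mult_left_mono E Y) auto
    finally have "integral {-T..T} (\<lambda>t. (cmod (F (Complex \<sigma> t)))\<^sup>2) \<le>
        D\<^sup>2 * (64 / k * (2 * Y * (R\<^sup>2 * S) + E))"
      by (simp add: mult_left_mono)
    then have "integral {-T..T} (\<lambda>t. (cmod (F (Complex \<sigma> t)))\<^sup>2) / (2 * T) \<le>
        D\<^sup>2 * (64 / k * (2 * Y * (R\<^sup>2 * S) + E)) / (2 * T)"
      using T by (intro divide_right_mono) auto
    also have "\<dots> = D\<^sup>2 * (64 / k) * ((2 * Y * (R\<^sup>2 * S) + E) / (2 * T))"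
      by (simp only: mult.assoc flip: times_divide_eq_right)
    also have "(2 * Y * (R\<^sup>2 * S) + E) / (2 * T) = k * (R\<^sup>2 * S) + ((C + R) * (R\<^sup>2 * S) + E / 2) / T"
      using T by (simp add: Y_def field_simps)
    finally show "integral {-T..T} (\<lambda>t. (cmod (F (Complex \<sigma> t)))\<^sup>2) / (2 * T) \<le> B T"
      by (simp add: B_def)
  qed
qed

section \<open>Coefficients as means\<close>

text \<open>
  Cauchy's theorem on the rectangle between the two lines.  The horizontal sides contribute a bounded
  amount, which disappears after division by \<open>2 * T\<close>.
\<close>
lemma coeff_mean_shift:
  assumes holo: "F holomorphic_on half_plane 0"
    and bound: "\<And>s. s \<in> half_plane 0 \<Longrightarrow> cmod (F s) \<le> M"
    and \<sigma>: "0 < \<sigma>" "\<sigma> < \<tau>"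
    and lim: "(coeff_mean F \<tau> n \<longlongrightarrow> b) at_top"
  shows "(coeff_mean F \<sigma> n \<longlongrightarrow> b) at_top"
proof -
  define G where "G = (\<lambda>s. F s * of_nat (Suc n) powr s)"
  define K where "K = M * real (Suc n) powr \<tau> * (\<tau> - \<sigma>)"
  have Gholo: "G holomorphic_on half_plane 0"
    unfolding G_def by (intro holomorphic_intros holo)
  have "M \<ge> 0"
    using bound[of 1] by (auto simp: half_plane_def intro: order_trans[OF norm_ge_zero])
  have side: "cmod (integral {\<sigma>..\<tau>} (\<lambda>x. G (Complex x y))) \<le> K" for y
    unfolding K_def
  proof (rule integral_bound)
    show "continuous_on {\<sigma>..\<tau>} (\<lambda>x. G (Complex x y))"
      by (intro continuous_on_compose2[OF holomorphic_on_imp_continuous_on[OF Gholo]] continuous_intros)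
        (use \<sigma> in \<open>auto simp: half_plane_def\<close>)
    show "cmod (G (Complex x y)) \<le> M * real (Suc n) powr \<tau>" if "x \<in> {\<sigma>..\<tau>}" for x
      unfolding G_def norm_mult norm_nat_powr using that \<sigma> \<open>M \<ge> 0\<close>
      by (intro mult_mono bound powr_mono) (auto simp: half_plane_def)
  qed (use \<sigma> in auto)
  have diff: "cmod (coeff_mean F \<sigma> n T - coeff_mean F \<tau> n T) \<le> K / T" if T: "T > 0" for T
  proof -
    have "\<i> * integral {-T..T} (\<lambda>y. G (Complex \<sigma> y)) =
      integral {\<sigma>..\<tau>} (\<lambda>x. G (Complex x (-T))) - integral {\<sigma>..\<tau>} (\<lambda>x. G (Complex x T))
      + \<i> * integral {-T..T} (\<lambda>y. G (Complex \<tau> y))"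
      by (rule rectangle_integrals_cancel[OF _ _ half_plane_properties(2) Gholo])
        (use T \<sigma> in \<open>auto simp: half_plane_def in_cbox_complex_iff\<close>)
    then have "\<i> * (integral {-T..T} (\<lambda>y. G (Complex \<sigma> y)) - integral {-T..T} (\<lambda>y. G (Complex \<tau> y))) =
      integral {\<sigma>..\<tau>} (\<lambda>x. G (Complex x (-T))) - integral {\<sigma>..\<tau>} (\<lambda>x. G (Complex x T))"
      by (simp add: algebra_simps)
    then have "cmod (integral {-T..T} (\<lambda>y. G (Complex \<sigma> y)) - integral {-T..T} (\<lambda>y. G (Complex \<tau> y))) =
      cmod (integral {\<sigma>..\<tau>} (\<lambda>x. G (Complex x (-T))) - integral {\<sigma>..\<tau>} (\<lambda>x. G (Complex x T)))"
      by (metis norm_mult norm_ii mult_1)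
    also have "\<dots> \<le> K + K"
      by (intro norm_triangle_le_diff add_mono side)
    finally have le: "cmod (integral {-T..T} (\<lambda>y. G (Complex \<sigma> y)) - integral {-T..T} (\<lambda>y. G (Complex \<tau> y))) \<le> 2 * K"
      by simp
    have "coeff_mean F \<sigma> n T - coeff_mean F \<tau> n T =
        (integral {-T..T} (\<lambda>y. G (Complex \<sigma> y)) - integral {-T..T} (\<lambda>y. G (Complex \<tau> y))) / of_real (2 * T)"
      by (simp add: coeff_mean_def G_def diff_divide_distrib)
    then have "cmod (coeff_mean F \<sigma> n T - coeff_mean F \<tau> n T) =
        cmod (integral {-T..T} (\<lambda>y. G (Complex \<sigma> y)) - integral {-T..T} (\<lambda>y. G (Complex \<tau> y))) / (2 * T)"
      using T by (simp add: norm_divide)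
    also have "\<dots> \<le> 2 * K / (2 * T)"
      using le T by (intro divide_right_mono) auto
    finally show ?thesis by simp
  qed
  have "((\<lambda>T. K / T) \<longlongrightarrow> 0) at_top"
    by (intro tendsto_divide_0[OF tendsto_const] filterlim_at_top_imp_at_infinity filterlim_ident)
  moreover have "\<forall>\<^sub>F T in at_top. norm (coeff_mean F \<sigma> n T - coeff_mean F \<tau> n T) \<le> K / T"
    using eventually_gt_at_top[of 0] by eventually_elim (rule diff)
  ultimately have "((\<lambda>T. coeff_mean F \<sigma> n T - coeff_mean F \<tau> n T) \<longlongrightarrow> 0) at_top"
    by (rule Lim_null_comparison[rotated])
  from tendsto_add[OF this lim] show ?thesis by simp
qed

text \<open>
  Expand the nonnegative mean of \<open>\<bar>F - P\<bar>\<^sup>2\<close>, where \<open>P\<close> is the Dirichlet polynomial whose coefficients are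
  the given ones.  Both the cross term and the mean of \<open>\<bar>P\<bar>\<^sup>2\<close> are combinations of coefficient means, of
  \<open>F\<close> and of \<open>P\<close>, with the same limit.
\<close>
lemma bessel_inequality_mean:
  assumes cont: "\<And>T. continuous_on {-T..T} (\<lambda>t. F (Complex \<sigma> t))"
    and coeff: "\<And>n. n < N \<Longrightarrow> (coeff_mean F \<sigma> n \<longlongrightarrow> b n) at_top"
    and B: "(B \<longlongrightarrow> \<beta>) at_top"
    and le: "\<And>T. T > 0 \<Longrightarrow> integral {-T..T} (\<lambda>t. (cmod (F (Complex \<sigma> t)))\<^sup>2) / (2 * T) \<le> B T"
  shows "(\<Sum>n<N. (cmod (b n))\<^sup>2 * real (Suc n) powr (-2 * \<sigma>)) \<le> \<beta>"
proof -
  \<comment> \<open>A coefficient sequence is read at \<open>Suc n\<close>, hence the shift of index.\<close>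
  define p where "p = (\<lambda>n. b (n - 1))"
  define P where "P = (\<lambda>s. \<Sum>n<N. dirichlet_term p s n)"
  define w where "w = (\<lambda>n. cnj (b n) * of_real (real (Suc n) powr (-2 * \<sigma>)))"
  define S where "S = (\<Sum>n<N. (cmod (b n))\<^sup>2 * real (Suc n) powr (-2 * \<sigma>))"
  have contP: "continuous_on A (\<lambda>t. P (Complex \<sigma> t))" for A
    unfolding P_def by (intro continuous_intros)
  have cnjP: "cnj (P (Complex \<sigma> t)) = (\<Sum>n<N. w n * of_nat (Suc n) powr Complex \<sigma> t)" for t
  proof -
    have "cnj (dirichlet_term p (Complex \<sigma> t) n) = w n * of_nat (Suc n) powr Complex \<sigma> t" for n
    proof -
      have "- Complex \<sigma> t = Complex (-\<sigma>) (-t)" by (simp add: complex_eq_iff)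
      moreover have "real (Suc n) powr (-2 * \<sigma>) * real (Suc n) powr \<sigma> = real (Suc n) powr (-\<sigma>)"
        by (simp flip: powr_add del: of_nat_Suc)
      ultimately show ?thesis
        unfolding dirichlet_term_def nat_powr_Complex w_def p_def
        by (simp add: exp_cnj nat_powr_Complex mult.assoc flip: of_real_mult del: of_nat_Suc)
    qed
    then show ?thesis by (simp add: P_def)
  qed
  have inner: "integral {-T..T} (\<lambda>t. Re (H (Complex \<sigma> t) * cnj (P (Complex \<sigma> t)))) / (2 * T) =
      Re (\<Sum>n<N. w n * coeff_mean H \<sigma> n T)"
    if H: "continuous_on {-T..T} (\<lambda>t. H (Complex \<sigma> t))" for H T
  proof -
    have "integral {-T..T} (\<lambda>t. Re (H (Complex \<sigma> t) * cnj (P (Complex \<sigma> t)))) =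
        Re (integral {-T..T} (\<lambda>t. H (Complex \<sigma> t) * cnj (P (Complex \<sigma> t))))"
      using integral_linear[OF integrable_continuous_interval bounded_linear_Re,
          of "-T" T "\<lambda>t. H (Complex \<sigma> t) * cnj (P (Complex \<sigma> t))"] H contP
      by (simp add: o_def continuous_on_mult continuous_on_cnj)
    also have "integral {-T..T} (\<lambda>t. H (Complex \<sigma> t) * cnj (P (Complex \<sigma> t))) =
        integral {-T..T} (\<lambda>t. \<Sum>n<N. w n * (H (Complex \<sigma> t) * of_nat (Suc n) powr Complex \<sigma> t))"
      unfolding cnjP by (simp only: sum_distrib_left mult_ac)
    also have "\<dots> = (\<Sum>n<N. integral {-T..T} (\<lambda>t. w n * (H (Complex \<sigma> t) * of_nat (Suc n) powr Complex \<sigma> t)))"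
      by (intro integral_sum integrable_continuous_interval continuous_intros H) auto
    finally show ?thesis
      by (simp add: coeff_mean_def Re_divide_of_real sum_divide_distrib)
  qed
  have ineq: "0 \<le> B T - 2 * Re (\<Sum>n<N. w n * coeff_mean F \<sigma> n T) + Re (\<Sum>n<N. w n * coeff_mean P \<sigma> n T)"
    if T: "T > 0" for T
  proof -
    have expand: "(cmod (F (Complex \<sigma> t) - P (Complex \<sigma> t)))\<^sup>2 =
        (cmod (F (Complex \<sigma> t)))\<^sup>2 - 2 * Re (F (Complex \<sigma> t) * cnj (P (Complex \<sigma> t)))
        + Re (P (Complex \<sigma> t) * cnj (P (Complex \<sigma> t)))" for t
      unfolding cmod_power2 by (simp add: power2_eq_square algebra_simps)
    have "0 \<le> integral {-T..T} (\<lambda>t. (cmod (F (Complex \<sigma> t) - P (Complex \<sigma> t)))\<^sup>2)"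
      by (intro integral_nonneg integrable_continuous_interval continuous_intros cont contP) auto
    also have "\<dots> = integral {-T..T} (\<lambda>t. (cmod (F (Complex \<sigma> t)))\<^sup>2)
        - 2 * integral {-T..T} (\<lambda>t. Re (F (Complex \<sigma> t) * cnj (P (Complex \<sigma> t))))
        + integral {-T..T} (\<lambda>t. Re (P (Complex \<sigma> t) * cnj (P (Complex \<sigma> t))))"
      unfolding expand
      by (subst integral_add integral_diff integral_mult_right;
          (intro integrable_continuous_interval continuous_intros cont contP)?)+ simp
    finally have "0 \<le> (integral {-T..T} (\<lambda>t. (cmod (F (Complex \<sigma> t)))\<^sup>2)
        - 2 * integral {-T..T} (\<lambda>t. Re (F (Complex \<sigma> t) * cnj (P (Complex \<sigma> t))))
        + integral {-T..T} (\<lambda>t. Re (P (Complex \<sigma> t) * cnj (P (Complex \<sigma> t))))) / (2 * T)"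
      using T by simp
    also have "\<dots> = integral {-T..T} (\<lambda>t. (cmod (F (Complex \<sigma> t)))\<^sup>2) / (2 * T)
        - 2 * (integral {-T..T} (\<lambda>t. Re (F (Complex \<sigma> t) * cnj (P (Complex \<sigma> t)))) / (2 * T))
        + integral {-T..T} (\<lambda>t. Re (P (Complex \<sigma> t) * cnj (P (Complex \<sigma> t)))) / (2 * T)"
      by (simp only: add_divide_distrib diff_divide_distrib times_divide_eq_right)
    finally show ?thesis
      unfolding inner[OF cont] inner[OF contP] using le[OF T] by linarith
  qed
  have limP: "(coeff_mean P \<sigma> n \<longlongrightarrow> b n) at_top" if "n < N" for n
    using coeff_mean_dirichlet_polynomial[where N = N and p = p and \<sigma> = \<sigma> and n = n] that by (simp add: P_def p_def)
  have wb: "(\<Sum>n<N. w n * b n) = of_real S"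
  proof -
    have "w n * b n = of_real ((cmod (b n))\<^sup>2 * real (Suc n) powr (-2 * \<sigma>))" for n
      unfolding w_def of_real_mult complex_norm_square by (simp only: mult_ac)
    then show ?thesis by (simp only: S_def of_real_sum)
  qed
  have "((\<lambda>T. B T - 2 * Re (\<Sum>n<N. w n * coeff_mean F \<sigma> n T) + Re (\<Sum>n<N. w n * coeff_mean P \<sigma> n T))
      \<longlongrightarrow> \<beta> - 2 * Re (\<Sum>n<N. w n * b n) + Re (\<Sum>n<N. w n * b n)) at_top"
    by (intro tendsto_intros B coeff limP) auto
  moreover have "\<forall>\<^sub>F T in at_top. 0 \<le> B T - 2 * Re (\<Sum>n<N. w n * coeff_mean F \<sigma> n T) + Re (\<Sum>n<N. w n * coeff_mean P \<sigma> n T)"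
    using eventually_gt_at_top[of 0] by eventually_elim (rule ineq)
  ultimately have "0 \<le> \<beta> - 2 * Re (\<Sum>n<N. w n * b n) + Re (\<Sum>n<N. w n * b n)"
    by (rule tendsto_lowerbound) simp
  then show ?thesis
    unfolding wb by (simp add: S_def)
qed

section \<open>Uniform limits of Dirichlet polynomials\<close>

definition dirichlet_sum :: "(complex \<Rightarrow> complex) \<Rightarrow> bool" where
  "dirichlet_sum g \<longleftrightarrow> (\<exists>N p. \<forall>s. g s = (\<Sum>k<N. dirichlet_term p s k))"

lemma dirichlet_sum_monomial: "dirichlet_sum (\<lambda>s. c * of_nat (Suc m) powr (- s))"
  unfolding dirichlet_sum_def
proof (intro exI allI)
  fix s
  show "c * of_nat (Suc m) powr (- s) = (\<Sum>k<Suc m. dirichlet_term (\<lambda>j. if j = Suc m then c else 0) s k)"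
    by (simp add: dirichlet_term_def)
qed

lemma dirichlet_sum_const: "dirichlet_sum (\<lambda>s. c)"
  using dirichlet_sum_monomial[of c 0] by simp

lemma dirichlet_sum_add:
  assumes "dirichlet_sum f" "dirichlet_sum g"
  shows "dirichlet_sum (\<lambda>s. f s + g s)"
proof -
  obtain N p M q where f: "\<And>s. f s = (\<Sum>k<N. dirichlet_term p s k)"
    and g: "\<And>s. g s = (\<Sum>k<M. dirichlet_term q s k)"
    using assms unfolding dirichlet_sum_def by metis
  define r where "r = (\<lambda>j. (if j \<le> N then p j else 0) + (if j \<le> M then q j else 0))"
  have "f s + g s = (\<Sum>k<max N M. dirichlet_term r s k)" for s
  proof -
    have "f s = (\<Sum>k<max N M. if k < N then dirichlet_term p s k else 0)"
      unfolding f by (rule sum.mono_neutral_cong_left) auto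
    moreover have "g s = (\<Sum>k<max N M. if k < M then dirichlet_term q s k else 0)"
      unfolding g by (rule sum.mono_neutral_cong_left) auto
    moreover have "dirichlet_term r s k =
      (if k < N then dirichlet_term p s k else 0) + (if k < M then dirichlet_term q s k else 0)" for k
      by (simp add: dirichlet_term_def r_def distrib_right Suc_le_eq del: of_nat_Suc)
    ultimately show ?thesis
      by (simp add: sum.distrib)
  qed
  then show ?thesis unfolding dirichlet_sum_def by blast
qed

lemma dirichlet_sum_sum:
  "(\<And>i. i \<in> A \<Longrightarrow> dirichlet_sum (f i)) \<Longrightarrow> dirichlet_sum (\<lambda>s. \<Sum>i\<in>A. f i s)"
  by (induction A rule: infinite_finite_induct) (auto intro: dirichlet_sum_const dirichlet_sum_add)

lemma dirichlet_sum_mult: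
  assumes "dirichlet_sum f" "dirichlet_sum g"
  shows "dirichlet_sum (\<lambda>s. f s * g s)"
proof -
  obtain N p M q where f: "\<And>s. f s = (\<Sum>k<N. dirichlet_term p s k)"
    and g: "\<And>s. g s = (\<Sum>k<M. dirichlet_term q s k)"
    using assms unfolding dirichlet_sum_def by metis
  have eq: "dirichlet_term p s k * dirichlet_term q s n =
      (p (Suc k) * q (Suc n)) * of_nat (Suc (Suc k * Suc n - 1)) powr (- s)" for s k n
  proof -
    have "of_nat (Suc (Suc k * Suc n - 1)) powr (- s) =
        of_nat (Suc k) powr (- s) * (of_nat (Suc n) powr (- s) :: complex)"
      using powr_times_real[of "of_nat (Suc k)" "of_nat (Suc n)" "-s"]
      by (simp del: mult_Suc mult_Suc_right of_nat_Suc flip: of_nat_mult)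
    then show ?thesis
      unfolding dirichlet_term_def by (simp only: mult_ac)
  qed
  have "dirichlet_sum (\<lambda>s. \<Sum>k<N. \<Sum>n<M. dirichlet_term p s k * dirichlet_term q s n)"
    unfolding eq by (intro dirichlet_sum_sum dirichlet_sum_monomial)
  then show ?thesis
    unfolding f g sum_product .
qed

lemma dirichlet_sum_bounded:
  assumes "dirichlet_sum f"
  obtains M where "\<And>s. Re s \<ge> 0 \<Longrightarrow> cmod (f s) \<le> M"
proof -
  obtain N p where f: "\<And>s. f s = (\<Sum>k<N. dirichlet_term p s k)"
    using assms unfolding dirichlet_sum_def by metis
  show ?thesis
  proof
    fix s :: complex assume s: "Re s \<ge> 0"
    show "cmod (f s) \<le> (\<Sum>k<N. cmod (p (Suc k)))"
      unfolding f
    proof (rule sum_norm_le)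
      fix k
      have "real (Suc k) powr (- Re s) \<le> real (Suc k) powr 0"
        using s by (intro powr_mono) auto
      then show "cmod (dirichlet_term p s k) \<le> cmod (p (Suc k))"
        unfolding norm_dirichlet_term by (simp add: mult_left_le del: of_nat_Suc)
    qed
  qed
qed

text \<open>
  Uniform approximability avoids all manipulation of products and exponentials of Dirichlet series:
  the approximable functions form an algebra closed under uniform limits, and coefficients can be recovered at the end.
  The bound \<open>3\<close> is a convenient abscissa beyond which every series that converges at \<open>1\<close> converges
  uniformly.
\<close>
definition dirichlet_approximable :: "(complex \<Rightarrow> complex) \<Rightarrow> bool" where
  "dirichlet_approximable g \<longleftrightarrow>
     (\<forall>\<epsilon>>0. \<exists>P. dirichlet_sum P \<and> (\<forall>s. Re s \<ge> 3 \<longrightarrow> cmod (g s - P s) \<le> \<epsilon>))"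

lemma dirichlet_sum_approximable: "dirichlet_sum g \<Longrightarrow> dirichlet_approximable g"
  unfolding dirichlet_approximable_def by (intro allI impI exI[of _ g]) simp

lemma dirichlet_approximable_uniform_limit:
  assumes lim: "uniform_limit {s. Re s \<ge> 3} f g sequentially"
    and f: "\<And>n. dirichlet_approximable (f n)"
  shows "dirichlet_approximable g"
  unfolding dirichlet_approximable_def
proof (intro allI impI)
  fix \<epsilon> :: real assume "\<epsilon> > 0"
  then have "\<epsilon> / 2 > 0" by simp
  then obtain n where n: "\<And>s. Re s \<ge> 3 \<Longrightarrow> dist (f n s) (g s) < \<epsilon> / 2"
    using lim unfolding uniform_limit_iff eventually_sequentially by blast
  obtain P where P: "dirichlet_sum P" "\<And>s. Re s \<ge> 3 \<Longrightarrow> cmod (f n s - P s) \<le> \<epsilon> / 2"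
    using f \<open>\<epsilon> / 2 > 0\<close> unfolding dirichlet_approximable_def by metis
  have "cmod (g s - P s) \<le> \<epsilon>" if "Re s \<ge> 3" for s
    using n[OF that] P(2)[OF that] norm_triangle_ineq[of "g s - f n s" "f n s - P s"]
    by (simp add: dist_norm norm_minus_commute)
  with P(1) show "\<exists>P. dirichlet_sum P \<and> (\<forall>s. Re s \<ge> 3 \<longrightarrow> cmod (g s - P s) \<le> \<epsilon>)"
    by blast
qed

lemma dirichlet_approximable_bounded:
  assumes "dirichlet_approximable g"
  obtains M where "M > 0" "\<And>s. Re s \<ge> 3 \<Longrightarrow> cmod (g s) \<le> M"
proof -
  obtain P where P: "dirichlet_sum P" "\<And>s. Re s \<ge> 3 \<Longrightarrow> cmod (g s - P s) \<le> 1"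
    using assms unfolding dirichlet_approximable_def by (metis zero_less_one)
  obtain M where M: "\<And>s. Re s \<ge> 0 \<Longrightarrow> cmod (P s) \<le> M"
    using dirichlet_sum_bounded[OF P(1)] by blast
  show ?thesis
  proof (rule that)
    show "max 1 (M + 1) > 0" by simp
    show "cmod (g s) \<le> max 1 (M + 1)" if "Re s \<ge> 3" for s
      using P(2)[OF that] M[of s] that norm_triangle_ineq[of "g s - P s" "P s"] by simp
  qed
qed

lemma dirichlet_approximable_mult:
  assumes f: "dirichlet_approximable f" and g: "dirichlet_approximable g"
  shows "dirichlet_approximable (\<lambda>s. f s * g s)"
  unfolding dirichlet_approximable_def
proof (intro allI impI)
  fix \<epsilon> :: real assume e: "\<epsilon> > 0"
  obtain M where M: "M > 0" "\<And>s. Re s \<ge> 3 \<Longrightarrow> cmod (f s) \<le> M"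
    using dirichlet_approximable_bounded[OF f] by blast
  have "\<epsilon> / (2 * M) > 0" using e M by simp
  then obtain Q where Q: "dirichlet_sum Q" "\<And>s. Re s \<ge> 3 \<Longrightarrow> cmod (g s - Q s) \<le> \<epsilon> / (2 * M)"
    using g unfolding dirichlet_approximable_def by metis
  obtain L where L: "L > 0" "\<And>s. Re s \<ge> 3 \<Longrightarrow> cmod (Q s) \<le> L"
    using dirichlet_approximable_bounded[OF dirichlet_sum_approximable[OF Q(1)]] by blast
  have "\<epsilon> / (2 * L) > 0" using e L by simp
  then obtain P where P: "dirichlet_sum P" "\<And>s. Re s \<ge> 3 \<Longrightarrow> cmod (f s - P s) \<le> \<epsilon> / (2 * L)"
    using f unfolding dirichlet_approximable_def by metis
  have "cmod (f s * g s - P s * Q s) \<le> \<epsilon>" if s: "Re s \<ge> 3" for s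
  proof -
    have "f s * g s - P s * Q s = f s * (g s - Q s) + (f s - P s) * Q s"
      by (simp add: algebra_simps)
    also have "cmod \<dots> \<le> cmod (f s) * cmod (g s - Q s) + cmod (f s - P s) * cmod (Q s)"
      by (metis norm_triangle_ineq norm_mult)
    also have "\<dots> \<le> M * (\<epsilon> / (2 * M)) + \<epsilon> / (2 * L) * L"
      using M L e by (intro add_mono mult_mono M(2) Q(2) P(2) L(2) s) auto
    also have "\<dots> = \<epsilon>"
      using M L by simp
    finally show ?thesis .
  qed
  with dirichlet_sum_mult[OF P(1) Q(1)]
  show "\<exists>P. dirichlet_sum P \<and> (\<forall>s. Re s \<ge> 3 \<longrightarrow> cmod (f s * g s - P s) \<le> \<epsilon>)"
    by blast
qed

lemma dirichlet_approximable_add: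
  assumes f: "dirichlet_approximable f" and g: "dirichlet_approximable g"
  shows "dirichlet_approximable (\<lambda>s. f s + g s)"
  unfolding dirichlet_approximable_def
proof (intro allI impI)
  fix \<epsilon> :: real assume "\<epsilon> > 0"
  then have "\<epsilon> / 2 > 0" by simp
  then obtain P Q where P: "dirichlet_sum P" "\<And>s. Re s \<ge> 3 \<Longrightarrow> cmod (f s - P s) \<le> \<epsilon> / 2"
    and Q: "dirichlet_sum Q" "\<And>s. Re s \<ge> 3 \<Longrightarrow> cmod (g s - Q s) \<le> \<epsilon> / 2"
    using f g unfolding dirichlet_approximable_def by metis
  have "cmod (f s + g s - (P s + Q s)) \<le> \<epsilon>" if "Re s \<ge> 3" for s
    using P(2)[OF that] Q(2)[OF that] norm_triangle_ineq[of "f s - P s" "g s - Q s"]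
    by (simp add: algebra_simps)
  with dirichlet_sum_add[OF P(1) Q(1)]
  show "\<exists>P. dirichlet_sum P \<and> (\<forall>s. Re s \<ge> 3 \<longrightarrow> cmod (f s + g s - P s) \<le> \<epsilon>)"
    by blast
qed

lemma dirichlet_approximable_const: "dirichlet_approximable (\<lambda>s. c)"
  by (intro dirichlet_sum_approximable dirichlet_sum_const)

lemma dirichlet_approximable_sum:
  "(\<And>i. i \<in> A \<Longrightarrow> dirichlet_approximable (f i)) \<Longrightarrow> dirichlet_approximable (\<lambda>s. \<Sum>i\<in>A. f i s)"
  by (induction A rule: infinite_finite_induct)
    (auto intro: dirichlet_approximable_const dirichlet_approximable_add)

lemma dirichlet_approximable_power:
  "dirichlet_approximable f \<Longrightarrow> dirichlet_approximable (\<lambda>s. f s ^ n)"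
  by (induction n) (auto intro: dirichlet_approximable_const dirichlet_approximable_mult)

lemma dirichlet_approximable_exp:
  assumes f: "dirichlet_approximable f"
  shows "dirichlet_approximable (\<lambda>s. exp (f s))"
proof -
  obtain M where M: "M > 0" "\<And>s. Re s \<ge> 3 \<Longrightarrow> cmod (f s) \<le> M"
    using dirichlet_approximable_bounded[OF f] by blast
  have "uniform_limit {s. Re s \<ge> 3} (\<lambda>n s. \<Sum>i<n. inverse (fact i) * f s ^ i)
      (\<lambda>s. suminf (\<lambda>i. inverse (fact i) * f s ^ i)) sequentially"
  proof (rule Weierstrass_m_test)
    show "summable (\<lambda>i. M ^ i /\<^sub>R fact i)"
      by (rule summable_exp_generic)
    show "norm (inverse (fact i) * f s ^ i) \<le> M ^ i /\<^sub>R fact i" if "s \<in> {s. Re s \<ge> 3}" for i s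
      using M(2)[of s] that by (simp add: norm_mult norm_inverse norm_power power_mono mult_left_mono)
  qed
  moreover have "(\<lambda>s. suminf (\<lambda>i. inverse (fact i) * f s ^ i)) = (\<lambda>s. exp (f s))"
    by (simp add: exp_def scaleR_conv_of_real)
  ultimately have lim: "uniform_limit {s. Re s \<ge> 3} (\<lambda>n s. \<Sum>i<n. inverse (fact i) * f s ^ i)
      (\<lambda>s. exp (f s)) sequentially"
    by (simp only:)
  show ?thesis
    by (rule dirichlet_approximable_uniform_limit[OF lim], rule dirichlet_approximable_sum,
        rule dirichlet_approximable_mult, rule dirichlet_approximable_const,
        rule dirichlet_approximable_power[OF f])
qed

lemma coeff_mean_diff_le:
  assumes "continuous_on {-T..T} (\<lambda>t. f (Complex \<sigma> t))" "continuous_on {-T..T} (\<lambda>t. g (Complex \<sigma> t))"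
    and le: "\<And>t. cmod (f (Complex \<sigma> t) - g (Complex \<sigma> t)) \<le> \<epsilon>" and T: "T > 0"
  shows "cmod (coeff_mean f \<sigma> n T - coeff_mean g \<sigma> n T) \<le> \<epsilon> * real (Suc n) powr \<sigma>"
proof -
  have int: "(\<lambda>t. h (Complex \<sigma> t) * of_nat (Suc n) powr Complex \<sigma> t) integrable_on {-T..T}"
    if "continuous_on {-T..T} (\<lambda>t. h (Complex \<sigma> t))" for h
    by (intro integrable_continuous_interval continuous_intros that)
  have "coeff_mean f \<sigma> n T - coeff_mean g \<sigma> n T =
      integral {-T..T} (\<lambda>t. (f (Complex \<sigma> t) - g (Complex \<sigma> t)) * of_nat (Suc n) powr Complex \<sigma> t)
      / of_real (2 * T)"
    unfolding coeff_mean_def diff_divide_distrib[symmetric] left_diff_distrib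
    by (simp only: integral_diff[OF int int] assms)
  moreover have "cmod (integral {-T..T} (\<lambda>t. (f (Complex \<sigma> t) - g (Complex \<sigma> t)) * of_nat (Suc n) powr Complex \<sigma> t))
      \<le> (\<epsilon> * real (Suc n) powr \<sigma>) * (T - (-T))"
  proof (rule integral_bound)
    show "continuous_on {-T..T} (\<lambda>t. (f (Complex \<sigma> t) - g (Complex \<sigma> t)) * of_nat (Suc n) powr Complex \<sigma> t)"
      by (intro continuous_intros assms)
    show "cmod ((f (Complex \<sigma> t) - g (Complex \<sigma> t)) * of_nat (Suc n) powr Complex \<sigma> t) \<le> \<epsilon> * real (Suc n) powr \<sigma>" for t
      unfolding norm_mult norm_nat_powr using le[of t] by (intro mult_mono) (auto intro: order_trans[OF norm_ge_zero])
  qed (use T in auto)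
  ultimately show ?thesis
    using T by (simp add: norm_divide pos_divide_le_eq)
qed

text \<open>
  The \<open>n\<close>th coefficients of approximating Dirichlet polynomials differ by at most the distance of the
  polynomials times \<open>(n + 1) ^ 3\<close>, because they are means over the line \<open>Re s = 3\<close>.  So they
  converge, and the limits are the coefficient means of \<open>g\<close>.  The factor \<open>(n + 1) ^ 3\<close> is harmless when
  \<open>Re s \<ge> 5\<close>, as \<open>(n + 1) powr (3 - 5)\<close> is summable.
\<close>
lemma dirichlet_approximable_coefficients:
  assumes app: "dirichlet_approximable g"
    and cont: "continuous_on {s. Re s \<ge> 3} g"
  obtains b where "\<And>n. (coeff_mean g 3 n \<longlongrightarrow> b (Suc n)) at_top"
    "\<And>s. Re s \<ge> 5 \<Longrightarrow> dirichlet_term b s sums g s"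
proof -
  have "\<forall>j. \<exists>N p. \<forall>s. Re s \<ge> 3 \<longrightarrow> cmod (g s - (\<Sum>k<N. dirichlet_term p s k)) \<le> 1 / real (Suc j)"
  proof
    fix j
    have "0 < 1 / real (Suc j)" by simp
    then show "\<exists>N p. \<forall>s. Re s \<ge> 3 \<longrightarrow> cmod (g s - (\<Sum>k<N. dirichlet_term p s k)) \<le> 1 / real (Suc j)"
      using app unfolding dirichlet_approximable_def dirichlet_sum_def by metis
  qed
  then obtain N p where Np: "\<And>j s. Re s \<ge> 3 \<Longrightarrow>
      cmod (g s - (\<Sum>k<N j. dirichlet_term (p j) s k)) \<le> 1 / real (Suc j)"
    by metis
  define P where "P = (\<lambda>j s. \<Sum>k<N j. dirichlet_term (p j) s k)"
  define q where "q = (\<lambda>j n. if n < N j then p j (Suc n) else 0)"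
  define e where "e = (\<lambda>j. 1 / real (Suc j))"
  have e: "e \<longlonglongrightarrow> 0"
    unfolding e_def using LIMSEQ_inverse_real_of_nat by (simp add: inverse_eq_divide)
  have close: "cmod (g s - P j s) \<le> e j" if "Re s \<ge> 3" for j s
    using Np that by (simp add: P_def e_def)
  have qlim: "(coeff_mean (P j) 3 n \<longlongrightarrow> q j n) at_top" for j n
    unfolding P_def q_def by (rule coeff_mean_dirichlet_polynomial)
  have contg: "continuous_on A (\<lambda>t. g (Complex 3 t))" for A
    by (intro continuous_on_compose2[OF cont] continuous_intros) auto
  have contP: "continuous_on A (\<lambda>t. P j (Complex 3 t))" for A j
    unfolding P_def by (intro continuous_intros)
  define w where "w = (\<lambda>n. real (Suc n) powr 3)"
  have gP: "cmod (coeff_mean g 3 n T - coeff_mean (P j) 3 n T) \<le> e j * w n" if "T > 0" for n T j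
    unfolding w_def by (intro coeff_mean_diff_le contg contP that close) simp
  have qdiff: "cmod (q i n - q j n) \<le> e i * w n + e j * w n" for i j n
  proof -
    have "((\<lambda>T. cmod (coeff_mean (P i) 3 n T - coeff_mean (P j) 3 n T)) \<longlongrightarrow> cmod (q i n - q j n)) at_top"
      by (intro tendsto_intros qlim)
    moreover have "\<forall>\<^sub>F T in at_top. cmod (coeff_mean (P i) 3 n T - coeff_mean (P j) 3 n T) \<le> e i * w n + e j * w n"
      using eventually_gt_at_top[of 0]
    proof eventually_elim
      case (elim T)
      have "cmod (coeff_mean (P i) 3 n T - coeff_mean (P j) 3 n T) \<le>
          cmod (coeff_mean g 3 n T - coeff_mean (P i) 3 n T) + cmod (coeff_mean g 3 n T - coeff_mean (P j) 3 n T)"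
        by (metis norm_minus_commute norm_diff_triangle_ineq diff_add_cancel norm_triangle_sub dist_norm dist_triangle2 dist_commute)
      then show ?case using gP[OF elim, of n i] gP[OF elim, of n j] by linarith
    qed
    ultimately show ?thesis by (rule tendsto_upperbound) simp
  qed
  have "\<exists>l. (\<lambda>j. q j n) \<longlonglongrightarrow> l" for n
  proof -
    have "Cauchy (\<lambda>j. q j n)"
    proof (rule CauchyI)
      fix \<epsilon> :: real assume "\<epsilon> > 0"
      have "(\<lambda>j. e j * w n) \<longlonglongrightarrow> 0 * w n"
        by (intro tendsto_intros e)
      then have "\<forall>\<^sub>F j in sequentially. e j * w n < \<epsilon> / 2"
        using \<open>\<epsilon> > 0\<close> by (intro order_tendstoD(2)) auto
      then obtain J where "\<And>j. j \<ge> J \<Longrightarrow> e j * w n < \<epsilon> / 2"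
        by (auto simp: eventually_sequentially)
      then have "cmod (q i n - q j n) < \<epsilon>" if "i \<ge> J" "j \<ge> J" for i j
        using qdiff[of i n j] that by (smt (verit) field_sum_of_halves)
      then show "\<exists>M. \<forall>m\<ge>M. \<forall>i\<ge>M. norm (q m n - q i n) < \<epsilon>" by blast
    qed
    then show ?thesis by (simp add: Cauchy_convergent_iff convergent_def)
  qed
  then obtain c where c: "\<And>n. (\<lambda>j. q j n) \<longlonglongrightarrow> c n" by metis
  have qc: "cmod (q j n - c n) \<le> e j * w n" for j n
  proof -
    have "(\<lambda>i. cmod (q j n - q i n)) \<longlonglongrightarrow> cmod (q j n - c n)"
      by (intro tendsto_intros c)
    moreover have "(\<lambda>i. e j * w n + e i * w n) \<longlonglongrightarrow> e j * w n + 0 * w n"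
      by (intro tendsto_intros e)
    ultimately have "cmod (q j n - c n) \<le> e j * w n + 0 * w n"
      by (rule LIMSEQ_le) (use qdiff in blast)
    then show ?thesis by simp
  qed
  define b where "b = (\<lambda>m. c (m - 1))"
  show ?thesis
  proof
    fix n
    show "(coeff_mean g 3 n \<longlongrightarrow> b (Suc n)) at_top"
    proof (rule tendstoI)
      fix \<epsilon> :: real assume "\<epsilon> > 0"
      have "(\<lambda>j. e j * w n) \<longlonglongrightarrow> 0 * w n"
        by (intro tendsto_intros e)
      then have "\<forall>\<^sub>F j in sequentially. e j * w n < \<epsilon> / 3"
        using \<open>\<epsilon> > 0\<close> by (intro order_tendstoD(2)) auto
      then obtain j where j: "e j * w n < \<epsilon> / 3"
        using eventually_happens'[OF sequentially_bot] by blast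
      have "\<forall>\<^sub>F T in at_top. dist (coeff_mean (P j) 3 n T) (q j n) < \<epsilon> / 3"
        using qlim \<open>\<epsilon> > 0\<close> by (intro tendstoD) auto
      then show "\<forall>\<^sub>F T in at_top. dist (coeff_mean g 3 n T) (b (Suc n)) < \<epsilon>"
        using eventually_gt_at_top[of 0]
      proof eventually_elim
        case (elim T)
        have "dist (coeff_mean g 3 n T) (c n) \<le> dist (coeff_mean g 3 n T) (coeff_mean (P j) 3 n T)
            + dist (coeff_mean (P j) 3 n T) (q j n) + dist (q j n) (c n)"
          by (smt (verit) dist_triangle)
        then show ?case
          using elim(1) gP[OF elim(2), of n j] qc[of j n] j by (simp add: b_def dist_norm)
      qed
    qed
  next
    fix s :: complex assume s: "Re s \<ge> 5"
    have w2: "w n * real (Suc n) powr (- Re s) \<le> 1 / (real (Suc n))\<^sup>2" for n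
    proof -
      have "w n * real (Suc n) powr (- Re s) = real (Suc n) powr (3 - Re s)"
        by (simp only: w_def powr_add[symmetric] diff_conv_add_uminus)
      also have "\<dots> \<le> real (Suc n) powr (-2)"
        using s by (intro powr_mono) auto
      also have "\<dots> = 1 / (real (Suc n))\<^sup>2"
        by (simp add: powr_minus divide_inverse del: of_nat_Suc)
      finally show ?thesis .
    qed
    have S: "summable (\<lambda>n. 1 / (real (Suc n))\<^sup>2)"
      using inverse_power_summable[of 2, where 'a = real]
      by (subst summable_Suc_iff[of "\<lambda>n. 1 / (real n)\<^sup>2"]) (simp add: inverse_eq_divide)
    define d where "d = (\<lambda>j n. (c n - q j n) * of_nat (Suc n) powr (-s))"
    have dle: "norm (d j n) \<le> e j * (1 / (real (Suc n))\<^sup>2)" for j n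
    proof -
      have "norm (d j n) = cmod (q j n - c n) * real (Suc n) powr (- Re s)"
        unfolding d_def norm_mult norm_nat_powr by (simp add: norm_minus_commute del: of_nat_Suc)
      also have "\<dots> \<le> (e j * w n) * real (Suc n) powr (- Re s)"
        by (intro mult_right_mono qc) auto
      also have "\<dots> \<le> e j * (1 / (real (Suc n))\<^sup>2)"
        unfolding mult.assoc by (intro mult_left_mono w2) (auto simp: e_def)
      finally show ?thesis .
    qed
    have dsum: "summable (d j)" for j
      by (rule summable_comparison_test'[OF summable_mult[OF S] dle])
    have dbound: "norm (suminf (d j)) \<le> e j * suminf (\<lambda>n. 1 / (real (Suc n))\<^sup>2)" for j
    proof -
      have "norm (suminf (d j)) \<le> suminf (\<lambda>n. e j * (1 / (real (Suc n))\<^sup>2))"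
        by (rule norm_suminf_le[OF dle summable_mult[OF S]])
      then show ?thesis by (simp only: suminf_mult[OF S])
    qed
    have "dirichlet_term b s sums (suminf (d j) + P j s)" for j
    proof -
      have "(\<lambda>n. if n \<in> {..<N j} then dirichlet_term (p j) s n else 0) sums P j s"
        unfolding P_def by (rule sums_If_finite_set) simp
      from sums_add[OF summable_sums[OF dsum[of j]] this]
      have "(\<lambda>n. d j n + (if n \<in> {..<N j} then dirichlet_term (p j) s n else 0)) sums (suminf (d j) + P j s)" .
      moreover have "d j n + (if n \<in> {..<N j} then dirichlet_term (p j) s n else 0) = dirichlet_term b s n" for n
        by (simp add: d_def b_def dirichlet_term_def q_def left_diff_distrib del: of_nat_Suc)
      ultimately show ?thesis by simp
    qed
    then have sb: "dirichlet_term b s sums suminf (dirichlet_term b s)"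
      and eq: "suminf (dirichlet_term b s) = suminf (d j) + P j s" for j
      using sums_unique by (auto simp: sums_iff)
    have "cmod (suminf (dirichlet_term b s) - g s) \<le> 0"
    proof (rule tendsto_lowerbound)
      show "(\<lambda>j. e j * suminf (\<lambda>n. 1 / (real (Suc n))\<^sup>2) + e j) \<longlonglongrightarrow> 0"
        using tendsto_add[OF tendsto_mult_right[OF e] e] by simp
      show "\<forall>\<^sub>F j in sequentially. cmod (suminf (dirichlet_term b s) - g s)
          \<le> e j * suminf (\<lambda>n. 1 / (real (Suc n))\<^sup>2) + e j"
      proof (intro always_eventually allI)
        fix j
        have "suminf (dirichlet_term b s) - g s = suminf (d j) - (g s - P j s)"
          by (simp add: eq[of j])
        also have "cmod \<dots> \<le> e j * suminf (\<lambda>n. 1 / (real (Suc n))\<^sup>2) + e j"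
          using s by (intro norm_triangle_le_diff add_mono dbound close) auto
        finally show "cmod (suminf (dirichlet_term b s) - g s)
          \<le> e j * suminf (\<lambda>n. 1 / (real (Suc n))\<^sup>2) + e j" .
      qed
    qed simp
    then show "dirichlet_term b s sums g s"
      using sb by simp
  qed
qed

section \<open>Convergent Dirichlet series are holomorphic\<close>

lemma summation_by_parts:
  fixes S w :: "nat \<Rightarrow> 'a::comm_ring"
  assumes "S 0 = 0"
  shows "(\<Sum>n<N. (S (Suc n) - S n) * w n) = S N * w N + (\<Sum>n<N. S (Suc n) * (w n - w (Suc n)))"
  using assms by (induction N) (simp_all add: algebra_simps)

text \<open>
  The quotient of consecutive powers is \<open>exp (- z * l)\<close> with \<open>l = ln (1 + 1 / (n + 1))\<close>, which is at most \<open>1 / (n + 1)\<close>.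
\<close>
lemma norm_nat_powr_diff_le:
  assumes "cmod z \<le> K"
  shows "cmod (of_nat (Suc n) powr (- z) - of_nat (Suc (Suc n)) powr (- z))
      \<le> K * exp K * real (Suc n) powr (- Re z - 1)"
proof -
  define l where "l = ln (real (Suc (Suc n))) - ln (real (Suc n))"
  have l0: "l \<ge> 0" by (simp add: l_def)
  have "ln (1 + 1 / real (Suc n)) \<le> 1 / real (Suc n)"
    by (rule ln_add_one_self_le_self) simp
  moreover have "1 + 1 / real (Suc n) = real (Suc (Suc n)) / real (Suc n)"
    by (simp add: field_simps)
  ultimately have "ln (real (Suc (Suc n)) / real (Suc n)) \<le> 1 / real (Suc n)"
    by metis
  then have l1: "l \<le> 1 / real (Suc n)"
    by (simp add: l_def ln_div del: of_nat_Suc)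
  have K: "K \<ge> 0" using assms norm_ge_zero order_trans by blast
  have split: "of_nat (Suc (Suc n)) powr (- z) = of_nat (Suc n) powr (- z) * exp (- z * of_real l)"
    by (simp add: powr_def Ln_of_nat l_def exp_add[symmetric] algebra_simps del: of_nat_Suc)
  have small: "cmod (- z * of_real l) \<le> K * (1 / real (Suc n))"
    unfolding norm_mult using assms l0 l1 K by (intro mult_mono) auto
  also have "\<dots> \<le> K" using K by (intro mult_left_le) auto
  finally have "\<bar>Re (- z * of_real l)\<bar> \<le> K"
    using abs_Re_le_cmod order_trans by blast
  have "cmod (exp (- z * of_real l) - 1) \<le> exp \<bar>Re (- z * of_real l)\<bar> * cmod (- z * of_real l)"
    using Taylor_exp[of "- z * of_real l" 0] by simp
  also have "\<dots> \<le> exp K * (K * (1 / real (Suc n)))"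
    using small \<open>\<bar>Re (- z * of_real l)\<bar> \<le> K\<close> by (intro mult_mono) auto
  finally have E: "cmod (exp (- z * of_real l) - 1) \<le> exp K * (K * (1 / real (Suc n)))" .
  have "of_nat (Suc n) powr (- z) - of_nat (Suc (Suc n)) powr (- z) =
      - (of_nat (Suc n) powr (- z) * (exp (- z * of_real l) - 1))"
    unfolding split by (simp add: algebra_simps)
  then have "cmod (of_nat (Suc n) powr (- z) - of_nat (Suc (Suc n)) powr (- z)) =
      real (Suc n) powr (- Re z) * cmod (exp (- z * of_real l) - 1)"
    by (simp only: norm_minus_cancel norm_mult norm_nat_powr uminus_complex.sel)
  also have "\<dots> \<le> real (Suc n) powr (- Re z) * (exp K * (K * (1 / real (Suc n))))"
    by (intro mult_left_mono E) auto
  also have "\<dots> = K * exp K * real (Suc n) powr (- Re z - 1)"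
    by (simp add: powr_diff del: of_nat_Suc)
  finally show ?thesis .
qed

lemma summable_nat_powr: "x < -1 \<Longrightarrow> summable (\<lambda>n. real (Suc n) powr x)"
  by (subst summable_Suc_iff[of "\<lambda>n. real n powr x"]) (simp add: summable_real_powr_iff)

lemma nat_powr_tendsto_zero:
  assumes "Re z > 0"
  shows "(\<lambda>n. of_nat (Suc n) powr (- z) :: complex) \<longlonglongrightarrow> 0"
proof (rule tendsto_norm_zero_cancel)
  have "(\<lambda>n. real n powr (- Re z)) \<longlonglongrightarrow> 0"
    using assms by (intro tendsto_neg_powr filterlim_real_sequentially) auto
  then have "(\<lambda>n. real (Suc n) powr (- Re z)) \<longlonglongrightarrow> 0"
    by (rule LIMSEQ_Suc)
  then show "(\<lambda>n. cmod (of_nat (Suc n) powr (- z))) \<longlonglongrightarrow> 0"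
    unfolding norm_nat_powr by simp
qed

text \<open>
  Abel summation: near \<open>s0\<close> the series is rewritten in terms of its bounded partial sums at a point
  \<open>e\<close> to the left, after which it converges absolutely and uniformly by the Weierstrass test.
\<close>
lemma dirichlet_holomorphic:
  assumes conv: "\<And>s. s \<in> half_plane 0 \<Longrightarrow> summable (dirichlet_term b s)"
  shows "dirichlet b holomorphic_on half_plane 0"
proof -
  have loc: "\<exists>r>0. ball s0 r \<subseteq> half_plane 0 \<and> dirichlet b holomorphic_on ball s0 r" if s0: "s0 \<in> half_plane 0" for s0
  proof -
    define e where "e = Re s0 / 3"
    have e: "e > 0" using s0 by (simp add: e_def half_plane_def)
    define S where "S = (\<lambda>n. \<Sum>k<n. dirichlet_term b (of_real e) k)"
    have "summable (dirichlet_term b (of_real e))"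
      using e by (intro conv) (simp add: half_plane_def)
    then have "convergent S"
      unfolding S_def by (simp add: summable_iff_convergent)
    then obtain M where M: "M > 0" "\<And>n. cmod (S n) \<le> M"
      using convergent_imp_Bseq by (metis Bseq_def)
    define w where "w = (\<lambda>s n. of_nat (Suc n) powr (- (s - of_real e)) :: complex)"
    define f where "f = (\<lambda>n s. S (Suc n) * (w s n - w s (Suc n)))"
    have pre: "Re s \<ge> 2 * e" "cmod (s - of_real e) \<le> cmod s0 + 2 * e" if "s \<in> cball s0 e" for s
    proof -
      have "cmod (s0 - s) \<le> e" using that by (simp add: dist_norm)
      then show "Re s \<ge> 2 * e"
        using abs_Re_le_cmod[of "s0 - s"] by (simp add: e_def)
      have "s - of_real e = s0 - (s0 - s) - of_real e" by simp
      also have "cmod \<dots> \<le> cmod s0 + cmod (s0 - s) + cmod (of_real e :: complex)"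
        by (intro norm_triangle_le_diff add_mono norm_triangle_ineq4 order_refl)
      finally show "cmod (s - of_real e) \<le> cmod s0 + 2 * e"
        using \<open>cmod (s0 - s) \<le> e\<close> e by simp
    qed
    define K where "K = cmod s0 + 2 * e"
    have ulim: "uniform_limit (cball s0 e) (\<lambda>N s. \<Sum>n<N. f n s) (\<lambda>s. suminf (\<lambda>n. f n s)) sequentially"
    proof (rule Weierstrass_m_test)
      show "summable (\<lambda>n. M * (K * exp K * real (Suc n) powr (- e - 1)))"
        using e by (intro summable_mult summable_nat_powr) simp
      show "norm (f n s) \<le> M * (K * exp K * real (Suc n) powr (- e - 1))" if "s \<in> cball s0 e" for n s
      proof -
        have "cmod (w s n - w s (Suc n)) \<le> K * exp K * real (Suc n) powr (- Re (s - of_real e) - 1)"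
          unfolding w_def using pre(2)[OF that] by (intro norm_nat_powr_diff_le) (simp add: K_def)
        also have "\<dots> \<le> K * exp K * real (Suc n) powr (- e - 1)"
          using pre(1)[OF that] e by (intro mult_left_mono powr_mono) (auto simp: K_def)
        finally show ?thesis
          unfolding f_def norm_mult using M by (intro mult_mono) auto
      qed
    qed
    have eq: "suminf (\<lambda>n. f n s) = dirichlet b s" if s: "s \<in> cball s0 e" for s
    proof -
      have sum1: "(\<Sum>n<N. dirichlet_term b s n) = S N * w s N + (\<Sum>n<N. f n s)" for N
      proof -
        have "dirichlet_term b s n = (S (Suc n) - S n) * w s n" for n
          by (simp add: S_def dirichlet_term_def w_def mult.assoc powr_add[symmetric] del: of_nat_Suc)
        then show ?thesis
          using summation_by_parts[of S "w s" N] by (simp add: S_def f_def)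
      qed
      have "(\<lambda>N. S N * w s N) \<longlonglongrightarrow> 0"
      proof (rule Lim_null_comparison)
        show "\<forall>\<^sub>F n in sequentially. norm (S n * w s n) \<le> M * norm (w s n)"
          using M by (auto simp: norm_mult mult_right_mono)
        have "(\<lambda>n. w s n) \<longlonglongrightarrow> 0"
          unfolding w_def using pre(1)[OF s] e by (intro nat_powr_tendsto_zero) simp
        then have "(\<lambda>n. norm (w s n)) \<longlonglongrightarrow> 0"
          by (rule tendsto_norm_zero)
        from tendsto_mult_left[OF this, of M] show "(\<lambda>n. M * norm (w s n)) \<longlonglongrightarrow> 0"
          by simp
      qed
      moreover have "(\<lambda>N. \<Sum>n<N. f n s) \<longlonglongrightarrow> suminf (\<lambda>n. f n s)"
        using tendsto_uniform_limitI[OF ulim s] .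
      ultimately have "(\<lambda>N. \<Sum>n<N. dirichlet_term b s n) \<longlonglongrightarrow> 0 + suminf (\<lambda>n. f n s)"
        unfolding sum1 by (rule tendsto_add)
      then show ?thesis
        unfolding dirichlet_def by (simp add: sums_def[symmetric] sums_iff)
    qed
    have fholo: "(\<lambda>s. \<Sum>n<N. f n s) holomorphic_on A" for N A
      unfolding f_def w_def by (intro holomorphic_intros)
    have "(\<lambda>s. suminf (\<lambda>n. f n s)) holomorphic_on ball s0 e"
      by (rule holomorphic_uniform_limit[OF _ ulim])
        (use fholo holomorphic_on_imp_continuous_on in \<open>auto simp: always_eventually\<close>)
    then have "dirichlet b holomorphic_on ball s0 e"
      by (rule holomorphic_transform) (simp add: eq)
    moreover have "ball s0 e \<subseteq> half_plane 0"
    proof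
      fix s assume "s \<in> ball s0 e"
      then have "2 * e \<le> Re s" using pre(1)[of s] by simp
      then show "s \<in> half_plane 0" using e by (simp add: half_plane_def)
    qed
    ultimately show ?thesis using e by blast
  qed
  show ?thesis
    unfolding holomorphic_on_def
  proof
    fix s0 assume "s0 \<in> half_plane 0"
    with loc obtain r where r: "r > 0" "dirichlet b holomorphic_on ball s0 r" by blast
    then have "dirichlet b field_differentiable at s0"
      by (meson centre_in_ball holomorphic_on_imp_differentiable_at open_ball)
    then show "dirichlet b field_differentiable at s0 within half_plane 0"
      by (rule field_differentiable_at_within)
  qed
qed

text \<open>
  The inequality between the arithmetic and the geometric mean, applied termwise.
\<close>
lemma summable_dirichlet_term_weighted_l2:
  assumes "summable (\<lambda>n. v n * (cmod (a (Suc n)))\<^sup>2)"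
    and "summable (\<lambda>n. real (Suc n) powr (-2 * Re s) / v n)"
    and v: "\<And>n. v n > 0"
  shows "summable (\<lambda>n. cmod (dirichlet_term a s n))"
proof (rule summable_comparison_test'[OF summable_add[OF assms(1,2)]])
  fix n
  define x y where "x = cmod (a (Suc n))" and "y = real (Suc n) powr (- Re s)"
  have y2: "real (Suc n) powr (-2 * Re s) = y\<^sup>2"
    by (simp add: y_def power2_eq_square flip: powr_add del: of_nat_Suc)
  have xy: "x \<ge> 0" "y \<ge> 0" by (simp_all add: x_def y_def)
  have "0 \<le> (v n * x - y)\<^sup>2" by simp
  then have "2 * (v n * x * y) \<le> v n * (v n * x\<^sup>2) + y\<^sup>2"
    by (simp add: power2_diff power_mult_distrib power2_eq_square algebra_simps)
  moreover have "0 \<le> v n * x * y" using v[of n] xy by simp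
  ultimately have "v n * (x * y) \<le> v n * (v n * x\<^sup>2) + y\<^sup>2" by linarith
  then have "x * y \<le> v n * x\<^sup>2 + y\<^sup>2 / v n"
    using v[of n] by (simp add: field_simps power2_eq_square)
  then show "norm (cmod (dirichlet_term a s n)) \<le> v n * (cmod (a (Suc n)))\<^sup>2 + real (Suc n) powr (-2 * Re s) / v n"
    unfolding y2 norm_dirichlet_term by (simp add: x_def y_def)
qed

lemma summable_dirichlet_term_l2:
  assumes "summable (\<lambda>n. (cmod (a (Suc n)))\<^sup>2)" and "Re s > 1/2"
  shows "summable (\<lambda>n. cmod (dirichlet_term a s n))"
  using summable_dirichlet_term_weighted_l2[of "\<lambda>_. 1" a s] assms summable_nat_powr[of "-2 * Re s"]
  by (simp del: of_nat_Suc)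

text \<open>
  Translation by \<open>1/2\<close> turns the coefficients into those of a series that converges on \<open>half_plane 0\<close>.
\<close>
lemma dirichlet_holomorphic_l2:
  assumes "summable (\<lambda>n. (cmod (a (Suc n)))\<^sup>2)"
  shows "dirichlet a holomorphic_on half_plane (1/2)"
proof -
  define c where "c = dirichlet_translate (1/2) a"
  have terms: "dirichlet_term c s n = dirichlet_term a (s + of_real (1/2)) n" for s n
    by (simp add: c_def dirichlet_term_def dirichlet_translate_def mult.assoc powr_add[symmetric] add.commute del: of_nat_Suc)
  have "summable (dirichlet_term c s)" if "s \<in> half_plane 0" for s
    using summable_norm_cancel[OF summable_dirichlet_term_l2[OF assms, of "s + of_real (1/2)"]] that
    unfolding terms[abs_def] by (simp add: half_plane_def)
  then have "dirichlet c holomorphic_on half_plane 0"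
    by (rule dirichlet_holomorphic)
  then have "(dirichlet c \<circ> (\<lambda>s. s - of_real (1/2))) holomorphic_on half_plane (1/2)"
    by (intro holomorphic_on_compose_gen[of _ _ _ "half_plane 0"] holomorphic_intros)
      (auto simp: half_plane_def)
  moreover have "dirichlet c \<circ> (\<lambda>s. s - of_real (1/2)) = dirichlet a"
    by (simp add: c_def dirichlet_dirichlet_translate fun_eq_iff)
  ultimately show ?thesis by simp
qed

section \<open>The two norms\<close>

text \<open>
  The true order of magnitude is \<open>1 / (1 + ln (n + 1))\<^sup>2\<close>; losing an arbitrarily small power of \<open>n + 1\<close>
  suffices for convergence in \<open>half_plane (1/2)\<close>.
\<close>
lemma A_weight_lower_bound:
  assumes d: "0 < d" "d \<le> 1"
  shows "d\<^sup>2 / 2 * real (Suc n) powr (-2 * d) \<le> A_weight n"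
proof -
  define q where "q = real (Suc n) powr (-2 * d)"
  have "((\<lambda>x. x * q) has_integral (q / 2 * d\<^sup>2 - q / 2 * 0\<^sup>2)) {0..d}"
  proof (rule fundamental_theorem_of_calculus)
    show "((\<lambda>x. q / 2 * x\<^sup>2) has_vector_derivative x * q) (at x within {0..d})" for x
      unfolding has_real_derivative_iff_has_vector_derivative[symmetric]
      by (rule derivative_eq_intros refl | simp)+
  qed (use d in simp)
  then have I: "((\<lambda>x. x * q) has_integral (d\<^sup>2 / 2 * q)) {0..d}" by (simp add: mult.commute)
  have int: "(\<lambda>x. x * real (Suc n) powr (-2 * x)) integrable_on {a..b}" for a b
    by (intro integrable_continuous_interval continuous_intros) (simp_all del: of_nat_Suc)
  have "d\<^sup>2 / 2 * q \<le> integral {0..d} (\<lambda>x. x * real (Suc n) powr (-2 * x))"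
    unfolding integral_unique[OF I, symmetric]
  proof (rule integral_le[OF has_integral_integrable[OF I] int])
    fix x assume x: "x \<in> {0..d}"
    then have "q \<le> real (Suc n) powr (-2 * x)"
      unfolding q_def by (intro powr_mono) auto
    then show "x * q \<le> x * real (Suc n) powr (-2 * x)"
      using x by (intro mult_left_mono) auto
  qed
  also have "\<dots> \<le> A_weight n"
    unfolding A_weight_def using d by (intro integral_subset_le int) auto
  finally show ?thesis by (simp add: q_def)
qed

lemma A_weight_pos: "A_weight n > 0"
proof -
  have "0 < 1\<^sup>2 / 2 * real (Suc n) powr (-2 * 1)" by simp
  also have "\<dots> \<le> A_weight n" by (rule A_weight_lower_bound) auto
  finally show ?thesis .
qed

lemma summable_dirichlet_term_A_weight:
  assumes a: "summable (\<lambda>n. A_weight n * (cmod (a (Suc n)))\<^sup>2)" and s: "Re s > 1/2"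
  shows "summable (dirichlet_term a s)"
proof (rule summable_norm_cancel, rule summable_dirichlet_term_weighted_l2[OF a _ A_weight_pos])
  \<comment> \<open>Any \<open>d\<close> in \<open>{0<..1}\<close> below \<open>Re s - 1/2\<close> works.\<close>
  define d where "d = min 1 ((Re s - 1/2) / 2)"
  have d: "0 < d" "d \<le> 1" "2 * d < 2 * Re s - 1"
    using s by (auto simp: d_def min_def)
  show "summable (\<lambda>n. real (Suc n) powr (-2 * Re s) / A_weight n)"
  proof (rule summable_comparison_test'[OF summable_mult[OF summable_nat_powr]])
    show "-2 * Re s + 2 * d < -1" using d by simp
    fix n
    have "real (Suc n) powr (-2 * Re s) / A_weight n \<le> real (Suc n) powr (-2 * Re s) / (d\<^sup>2 / 2 * real (Suc n) powr (-2 * d))"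
      using A_weight_lower_bound[OF d(1,2), of n] d A_weight_pos[of n]
      by (intro divide_left_mono mult_pos_pos) (auto simp del: of_nat_Suc)
    also have "\<dots> = 2 / d\<^sup>2 * real (Suc n) powr (-2 * Re s + 2 * d)"
    proof -
      have "real (Suc n) powr (-2 * Re s + 2 * d) = real (Suc n) powr (-2 * Re s) / real (Suc n) powr (-2 * d)"
        by (simp flip: powr_diff)
      then show ?thesis by simp
    qed
    finally show "norm (real (Suc n) powr (-2 * Re s) / A_weight n) \<le> 2 / d\<^sup>2 * real (Suc n) powr (-2 * Re s + 2 * d)"
      using A_weight_pos[of n] by simp
  qed
qed

lemma A_norm_sq_eq: "A_norm_sq a = (\<Sum>n. ennreal (A_weight n * (cmod (a (Suc n)))\<^sup>2))"
proof -
  define g where "g = (\<lambda>n \<sigma>. (cmod (a (Suc n)))\<^sup>2 * (\<sigma> * real (Suc n) powr (-2 * \<sigma>)))"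
  have each: "(\<integral>\<^sup>+\<sigma>. ennreal (indicator {0..1} \<sigma> * g n \<sigma>) \<partial>lborel) = ennreal (A_weight n * (cmod (a (Suc n)))\<^sup>2)" for n
  proof (rule nn_integral_has_integral_lebesgue)
    have "(\<lambda>x. x * real (Suc n) powr (-2 * x)) integrable_on {0..1}"
      by (intro integrable_continuous_interval continuous_intros) (simp_all del: of_nat_Suc)
    from has_integral_mult_right[OF integrable_integral[OF this], of "(cmod (a (Suc n)))\<^sup>2"]
    show "(g n has_integral (A_weight n * (cmod (a (Suc n)))\<^sup>2)) {0..1}"
      by (simp add: g_def A_weight_def mult.commute)
  qed (auto simp: g_def)
  have point: "H_norm_sq (dirichlet_translate \<sigma> a) * ennreal \<sigma> * indicator {0..1} \<sigma> =
      (\<Sum>n. ennreal (indicator {0..1} \<sigma> * g n \<sigma>))" for \<sigma>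
  proof (cases "\<sigma> \<in> {0..1}")
    case True
    have "cmod (of_nat (Suc n) powr (- complex_of_real \<sigma>)) = real (Suc n) powr (- \<sigma>)" for n
      by (simp only: norm_nat_powr uminus_complex.sel Re_complex_of_real)
    then have "(cmod (dirichlet_translate \<sigma> a (Suc n)))\<^sup>2 = (cmod (a (Suc n)))\<^sup>2 * real (Suc n) powr (-2 * \<sigma>)" for n
      by (simp add: dirichlet_translate_def norm_mult power_mult_distrib power2_eq_square flip: powr_add del: of_nat_Suc)
    then have "H_norm_sq (dirichlet_translate \<sigma> a) * ennreal \<sigma> =
        (\<Sum>n. ennreal ((cmod (a (Suc n)))\<^sup>2 * real (Suc n) powr (-2 * \<sigma>)) * ennreal \<sigma>)"
      by (simp add: H_norm_sq_def del: of_nat_Suc)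
    also have "\<dots> = (\<Sum>n. ennreal (g n \<sigma>))"
      using True by (intro arg_cong[where f = suminf] ext)
        (simp add: g_def ennreal_mult'[symmetric] mult_ac del: of_nat_Suc)
    finally show ?thesis using True by simp
  qed simp
  have "A_norm_sq a = (\<integral>\<^sup>+\<sigma>. (\<Sum>n. ennreal (indicator {0..1} \<sigma> * g n \<sigma>)) \<partial>lborel)"
    unfolding A_norm_sq_def point ..
  also have "\<dots> = (\<Sum>n. \<integral>\<^sup>+\<sigma>. ennreal (indicator {0..1} \<sigma> * g n \<sigma>) \<partial>lborel)"
    unfolding g_def by (intro nn_integral_suminf) measurable
  finally show ?thesis by (simp only: each)
qed

lemma A_space_summable:
  assumes "a \<in> A_space"
  shows "summable (\<lambda>n. A_weight n * (cmod (a (Suc n)))\<^sup>2)"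
proof -
  obtain P where P: "\<And>k. dirichlet_polynomial (P k)" "(\<lambda>k::nat. A_norm_sq (\<lambda>n. a n - P k n)) \<longlonglongrightarrow> 0"
    using assms unfolding A_space_def by blast
  have "\<forall>\<^sub>F k in sequentially. A_norm_sq (\<lambda>n. a n - P k n) < 1"
    using P(2) by (intro order_tendstoD(2)) auto
  then obtain k where k: "A_norm_sq (\<lambda>n. a n - P k n) < 1"
    using eventually_happens'[OF sequentially_bot] by blast
  define W where "W = (\<lambda>c n. A_weight n * (cmod (c (Suc n)))\<^sup>2)"
  have W0: "W c n \<ge> 0" for c n
    using A_weight_pos[of n] by (simp add: W_def)
  have s1: "summable (W (\<lambda>n. a n - P k n))"
    using k W0 unfolding A_norm_sq_eq W_def
    by (intro summable_suminf_not_top) auto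
  have "finite {n. P k n \<noteq> 0}"
    using P(1) by (simp add: dirichlet_polynomial_def)
  then have "finite {n. P k (Suc n) \<noteq> 0}"
    using finite_vimageI[OF _ inj_Suc] by (fastforce simp: vimage_def)
  then have s2: "summable (W (P k))"
    by (rule summable_finite) (auto simp: W_def)
  have "W a n \<le> 2 * W (\<lambda>n. a n - P k n) n + 2 * W (P k) n" for n
  proof -
    define x y where "x = cmod (a (Suc n) - P k (Suc n))" and "y = cmod (P k (Suc n))"
    have "cmod (a (Suc n)) \<le> x + y"
      unfolding x_def y_def using norm_triangle_ineq[of "a (Suc n) - P k (Suc n)" "P k (Suc n)"] by simp
    then have "(cmod (a (Suc n)))\<^sup>2 \<le> (x + y)\<^sup>2"
      by (intro power_mono) auto
    also have "\<dots> \<le> 2 * x\<^sup>2 + 2 * y\<^sup>2"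
      using zero_le_power2[of "x - y"] by (simp add: power2_eq_square algebra_simps)
    finally have "A_weight n * (cmod (a (Suc n)))\<^sup>2 \<le> A_weight n * (2 * x\<^sup>2 + 2 * y\<^sup>2)"
      using A_weight_pos[of n] by (intro mult_left_mono) auto
    then show ?thesis
      by (simp add: W_def x_def y_def algebra_simps)
  qed
  then have "summable (W a)"
    using W0 by (intro summable_comparison_test'[OF summable_add[OF summable_mult[OF s1, of 2] summable_mult[OF s2, of 2]]]) auto
  then show ?thesis by (simp add: W_def)
qed

lemma A_norm_eq:
  assumes "summable (\<lambda>n. A_weight n * (cmod (a (Suc n)))\<^sup>2)"
  shows "A_norm a = sqrt (\<Sum>n. A_weight n * (cmod (a (Suc n)))\<^sup>2)"
proof -
  have nonneg: "0 \<le> A_weight n * (cmod (a (Suc n)))\<^sup>2" for n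
    using A_weight_pos[of n] by simp
  then have "A_norm_sq a = ennreal (\<Sum>n. A_weight n * (cmod (a (Suc n)))\<^sup>2)"
    unfolding A_norm_sq_eq using assms by (intro suminf_ennreal2)
  then show ?thesis
    unfolding A_norm_def using suminf_nonneg[OF assms nonneg] by simp
qed

lemma H_norm_eq:
  assumes "summable (\<lambda>n. (cmod (a (Suc n)))\<^sup>2)"
  shows "a \<in> H_space" "H_norm a = sqrt (\<Sum>n. (cmod (a (Suc n)))\<^sup>2)"
proof -
  have "H_norm_sq a = ennreal (\<Sum>n. (cmod (a (Suc n)))\<^sup>2)"
    unfolding H_norm_sq_def using assms by (intro suminf_ennreal2) auto
  then show "a \<in> H_space" "H_norm a = sqrt (\<Sum>n. (cmod (a (Suc n)))\<^sup>2)"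
    using assms by (auto simp: H_space_def H_norm_def suminf_nonneg)
qed

section \<open>Images of Dirichlet polynomials\<close>

lemma uniform_dirichlet_holomorphic:
  assumes "\<And>\<epsilon>. \<epsilon> > 0 \<Longrightarrow> uniform_limit (half_plane \<epsilon>)
      (\<lambda>N s. \<Sum>n<N. dirichlet_term c s n) (dirichlet c) sequentially"
  shows "dirichlet c holomorphic_on half_plane 0"
proof (rule dirichlet_holomorphic)
  fix s assume "s \<in> half_plane 0"
  then have s: "Re s / 2 > 0" "s \<in> half_plane (Re s / 2)"
    by (auto simp: half_plane_def)
  have "(\<lambda>N. \<Sum>n<N. dirichlet_term c s n) \<longlonglongrightarrow> dirichlet c s"
    by (rule tendsto_uniform_limitI[OF assms[OF s(1)] s(2)])
  then show "summable (dirichlet_term c s)"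
    by (auto simp: summable_def sums_def)
qed

lemma dirichlet_approximable_uniform_dirichlet:
  assumes "uniform_limit {s. Re s \<ge> 3} (\<lambda>N s. \<Sum>n<N. dirichlet_term c s n) (dirichlet c) sequentially"
  shows "dirichlet_approximable (dirichlet c)"
  by (rule dirichlet_approximable_uniform_limit[OF assms], rule dirichlet_sum_approximable)
    (auto simp: dirichlet_sum_def)

lemma dirichlet_approximable_dirichlet:
  assumes "summable (dirichlet_term b 1)"
  shows "dirichlet_approximable (dirichlet b)"
proof (rule dirichlet_approximable_uniform_dirichlet)
  have "dirichlet_term b 1 \<longlonglongrightarrow> 0"
    using assms by (rule summable_LIMSEQ_zero)
  then obtain M where M: "M > 0" "\<And>n. cmod (dirichlet_term b 1 n) \<le> M"
    using convergent_imp_Bseq[of "dirichlet_term b 1"] by (auto simp: convergent_def Bseq_def)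
  show "uniform_limit {s. Re s \<ge> 3} (\<lambda>N s. \<Sum>n<N. dirichlet_term b s n) (dirichlet b) sequentially"
    unfolding dirichlet_def[abs_def]
  proof (rule Weierstrass_m_test)
    show "summable (\<lambda>n. M * real (Suc n) powr (-2))"
      by (intro summable_mult summable_nat_powr) simp
    fix n s assume "s \<in> {s. Re s \<ge> 3}"
    then have "cmod (dirichlet_term b s n) \<le> cmod (b (Suc n)) * real (Suc n) powr (-1 + -2)"
      unfolding norm_dirichlet_term by (intro mult_left_mono powr_mono) auto
    also have "\<dots> = cmod (dirichlet_term b 1 n) * real (Suc n) powr (-2)"
      unfolding norm_dirichlet_term powr_add by simp
    also have "\<dots> \<le> M * real (Suc n) powr (-2)"
      by (intro mult_right_mono M) auto
    finally show "norm (dirichlet_term b s n) \<le> M * real (Suc n) powr (-2)" .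
  qed
qed

text \<open>
  Since \<open>c0\<close> is an integer, \<open>(n + 1) powr (- c0 * s)\<close> is again a Dirichlet monomial; the other factor of
  \<open>(n + 1) powr (- \<phi> s)\<close> is the exponential of a multiple of \<open>dirichlet c\<close>.
\<close>
lemma dirichlet_approximable_composed_term:
  assumes "dirichlet_approximable (dirichlet c)"
  shows "dirichlet_approximable (\<lambda>s. dirichlet_term a (gh_map c0 c s) n)"
proof -
  have "of_nat (Suc n) powr (- gh_map c0 c s) =
      1 * of_nat (Suc (Suc n ^ c0 - 1)) powr (- s) * exp (- of_real (ln (real (Suc n))) * dirichlet c s)" for s
  proof -
    have "Suc (Suc n ^ c0 - 1) = Suc n ^ c0"
      by (simp del: power_Suc)
    moreover have "of_nat (Suc n ^ c0) powr (- s) = exp (- s * of_real (real c0 * ln (real (Suc n))))"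
    proof -
      have "ln (real (Suc n ^ c0)) = real c0 * ln (real (Suc n))"
        by (simp add: ln_realpow del: of_nat_Suc)
      then show ?thesis
        by (simp add: powr_def Ln_of_nat del: of_nat_Suc of_nat_power)
    qed
    moreover have "of_nat (Suc n) powr (- gh_map c0 c s) =
        exp (- s * of_real (real c0 * ln (real (Suc n)))) * exp (- of_real (ln (real (Suc n))) * dirichlet c s)"
      by (simp add: powr_def Ln_of_nat gh_map_def exp_add[symmetric] algebra_simps del: of_nat_Suc)
    ultimately show ?thesis by (simp only: mult_1)
  qed
  then have eq: "dirichlet_term a (gh_map c0 c s) n = a (Suc n) * (1 * of_nat (Suc (Suc n ^ c0 - 1)) powr (- s) *
      exp (- of_real (ln (real (Suc n))) * dirichlet c s))" for s
    by (simp only: dirichlet_term_def)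
  show ?thesis
    unfolding eq
    by (rule dirichlet_approximable_mult, rule dirichlet_approximable_const,
        rule dirichlet_approximable_mult, rule dirichlet_sum_approximable, rule dirichlet_sum_monomial,
        rule dirichlet_approximable_exp, rule dirichlet_approximable_mult,
        rule dirichlet_approximable_const, rule assms)
qed

lemma gordon_hedenmalm_Re_pos:
  assumes "gordon_hedenmalm c0 c" "c0 \<ge> 1" "s \<in> half_plane 0"
  shows "Re (gh_map c0 c s) > 0"
proof -
  have "Re (dirichlet c s) \<ge> 0"
    using assms unfolding gordon_hedenmalm_def half_plane_def by force
  moreover have "Re (of_nat c0 * s) > 0"
    using assms by (simp add: half_plane_def)
  ultimately show ?thesis by (simp add: gh_map_def)
qed

text \<open>
  Approximability on \<open>Re s \<ge> 3\<close> provides the coefficients \<open>d\<close>.  As \<open>F\<close> is bounded on \<open>half_plane 0\<close>, they are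
  also its coefficient means on the lines \<open>Re s = \<sigma>\<close> with \<open>0 < \<sigma> \<le> 1\<close>, where the mean square of \<open>F\<close> is controlled
  uniformly in \<open>\<sigma>\<close>; letting \<open>\<sigma>\<close> tend to \<open>0\<close> bounds the sum of squares.  The identity between the
  series and \<open>F\<close> then spreads by analytic continuation.  The coefficient means in the conclusion make
  \<open>d\<close> depend linearly on \<open>a\<close>.
\<close>
lemma weighted_composition_dirichlet_polynomial:
  fixes c0 N :: nat and C :: real and c b a :: "nat \<Rightarrow> complex"
  defines "F \<equiv> (\<lambda>s. dirichlet b s * (\<Sum>n<N. dirichlet_term a (gh_map c0 c s) n))"
  assumes gh: "gordon_hedenmalm c0 c" and c0: "c0 \<ge> 1" and C: "C > 0"
    and conv: "\<And>s. s \<in> half_plane 0 \<Longrightarrow> summable (dirichlet_term b s)"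
    and psi: "\<And>s. s \<in> half_plane 0 \<Longrightarrow> cmod (dirichlet c s) \<le> C"
    and u: "\<And>s. s \<in> half_plane 0 \<Longrightarrow> cmod (dirichlet b s) \<le> C * Re (gh_map c0 c s)"
  obtains d where "\<And>n. (coeff_mean F 3 n \<longlongrightarrow> d (Suc n)) at_top"
    "\<And>s. s \<in> half_plane (1/2) \<Longrightarrow> dirichlet_term d s sums F s"
    "\<And>M. (\<Sum>n<M. (cmod (d (Suc n)))\<^sup>2) \<le>
        144 * C\<^sup>2 * (real c0 + C)\<^sup>2 * (\<Sum>n<N. A_weight n * (cmod (a (Suc n)))\<^sup>2)"
    "continuous_on {s. Re s \<ge> 3} F"
proof -
  define \<phi> where "\<phi> = gh_map c0 c"
  define K where "K = 144 * C\<^sup>2 * (real c0 + C)\<^sup>2 * (\<Sum>n<N. A_weight n * (cmod (a (Suc n)))\<^sup>2)"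
  have ulim: "uniform_limit (half_plane \<epsilon>) (\<lambda>N s. \<Sum>n<N. dirichlet_term c s n) (dirichlet c) sequentially"
    if "\<epsilon> > 0" for \<epsilon>
    using gh that unfolding gordon_hedenmalm_def by blast
  have psi_holo: "dirichlet c holomorphic_on half_plane 0"
    by (rule uniform_dirichlet_holomorphic[OF ulim])
  have phi_holo: "\<phi> holomorphic_on half_plane 0"
    unfolding \<phi>_def gh_map_def[abs_def] by (intro holomorphic_intros psi_holo)
  have u_holo: "dirichlet b holomorphic_on half_plane 0"
    by (rule dirichlet_holomorphic[OF conv])
  have pos: "Re (\<phi> s) > 0" if "s \<in> half_plane 0" for s
    unfolding \<phi>_def by (rule gordon_hedenmalm_Re_pos[OF gh c0 that])
  have near: "cmod (\<phi> s - of_real (real c0) * s) \<le> C" if "s \<in> half_plane 0" for s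
    using psi[OF that] by (simp add: \<phi>_def gh_map_def)
  define f where "f = (\<lambda>s. \<Sum>n<N. dirichlet_term a s n)"
  have F: "F = (\<lambda>s. dirichlet b s * f (\<phi> s))"
    by (simp add: F_def f_def \<phi>_def)
  have f_holo: "f holomorphic_on A" for A
    unfolding f_def by (intro holomorphic_intros holomorphic_dirichlet_term)
  have F_holo: "F holomorphic_on half_plane 0"
    unfolding F using holomorphic_on_compose[OF phi_holo f_holo]
    by (intro holomorphic_intros u_holo) (simp add: o_def)
  have F_cont: "continuous_on A F" if "A \<subseteq> half_plane 0" for A
    using F_holo that holomorphic_on_imp_continuous_on continuous_on_subset by blast
  have app_u: "dirichlet_approximable (dirichlet b)"
    by (intro dirichlet_approximable_dirichlet conv) (simp add: half_plane_def)
  have app_psi: "dirichlet_approximable (dirichlet c)"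
    by (intro dirichlet_approximable_uniform_dirichlet uniform_limit_on_subset[OF ulim[of 2]])
      (auto simp: half_plane_def)
  have app_F: "dirichlet_approximable F"
    unfolding F_def by (intro dirichlet_approximable_mult app_u dirichlet_approximable_sum
        dirichlet_approximable_composed_term app_psi)
  have cont3: "continuous_on {s. Re s \<ge> 3} F"
    by (rule F_cont) (auto simp: half_plane_def)
  obtain d where d: "\<And>n. (coeff_mean F 3 n \<longlongrightarrow> d (Suc n)) at_top"
      "\<And>s. Re s \<ge> 5 \<Longrightarrow> dirichlet_term d s sums F s"
    using dirichlet_approximable_coefficients[OF app_F cont3] by blast
  obtain B where B: "cmod (F s) \<le> B" if "s \<in> half_plane 0" for s
  proof -
    obtain M where M: "\<And>s. Re s \<ge> 0 \<Longrightarrow> cmod (f s) \<le> M"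
      using dirichlet_sum_bounded[of f] unfolding dirichlet_sum_def f_def by blast
    obtain L where L: "L > 0" "\<And>s. Re s \<ge> 3 \<Longrightarrow> cmod (dirichlet b s) \<le> L"
      using dirichlet_approximable_bounded[OF app_u] by blast
    \<comment> \<open>For \<open>Re s \<ge> 3\<close> the series of \<open>dirichlet b\<close> is bounded; closer to the imaginary axis its bound in terms
      of \<open>Re (\<phi> s)\<close> takes over.\<close>
    define U where "U = max L (C * (3 * real c0 + C))"
    have "cmod (F s) \<le> U * M" if s: "s \<in> half_plane 0" for s
    proof -
      have "cmod (dirichlet b s) \<le> U"
      proof (cases "Re s \<ge> 3")
        case True
        then show ?thesis using L(2) by (simp add: U_def le_max_iff_disj)
      next
        case False
        have "Re (\<phi> s) \<le> real c0 * Re s + C"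
          using psi[OF s] abs_Re_le_cmod[of "dirichlet c s"] by (simp add: \<phi>_def gh_map_def)
        also have "\<dots> \<le> real c0 * 3 + C"
          using False by (intro add_right_mono mult_left_mono) auto
        finally have "C * Re (\<phi> s) \<le> C * (3 * real c0 + C)"
          using C by (intro mult_left_mono) auto
        then show ?thesis using u[OF s] by (simp add: U_def \<phi>_def)
      qed
      moreover have "cmod (f (\<phi> s)) \<le> M"
        using M pos[OF s] by simp
      ultimately show ?thesis
        unfolding F norm_mult using L(1) by (intro mult_mono) (auto simp: U_def)
    qed
    then show ?thesis by (rule that)
  qed
  have bessel: "(\<Sum>n<M. (cmod (d (Suc n)))\<^sup>2 * real (Suc n) powr (-2 * \<sigma>)) \<le> K"
    if \<sigma>: "0 < \<sigma>" "\<sigma> \<le> 1" for \<sigma> M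
  proof -
    obtain E where E: "(E \<longlongrightarrow> K) at_top"
      "\<And>T. T > 0 \<Longrightarrow> integral {-T..T} (\<lambda>t. (cmod (F (Complex \<sigma> t)))\<^sup>2) / (2 * T) \<le> E T"
      unfolding K_def
      using mean_square_weighted_composition_le[OF phi_holo pos near
          holomorphic_on_imp_continuous_on[OF u_holo] u[folded \<phi>_def] _ _ _ \<sigma> F[unfolded f_def]]
        c0 C by auto
    show ?thesis
    proof (rule bessel_inequality_mean[OF _ _ E])
      show "continuous_on {-T..T} (\<lambda>t. F (Complex \<sigma> t))" for T
        by (intro continuous_on_compose2[OF F_cont[OF order_refl]] continuous_intros)
          (use \<sigma> in \<open>auto simp: half_plane_def\<close>)
      show "(coeff_mean F \<sigma> n \<longlongrightarrow> d (Suc n)) at_top" for n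
        using \<sigma> by (intro coeff_mean_shift[OF F_holo B _ _ d(1)]) auto
    qed
  qed
  have sq: "(\<Sum>n<M. (cmod (d (Suc n)))\<^sup>2) \<le> K" for M
  proof (rule tendsto_upperbound)
    show "((\<lambda>\<sigma>. \<Sum>n<M. (cmod (d (Suc n)))\<^sup>2 * real (Suc n) powr (-2 * \<sigma>)) \<longlongrightarrow> (\<Sum>n<M. (cmod (d (Suc n)))\<^sup>2)) (at_right 0)"
    proof -
      have "((\<lambda>\<sigma>. \<Sum>n<M. (cmod (d (Suc n)))\<^sup>2 * real (Suc n) powr (-2 * \<sigma>))
          \<longlongrightarrow> (\<Sum>n<M. (cmod (d (Suc n)))\<^sup>2 * real (Suc n) powr (-2 * 0))) (at_right 0)"
        by (intro tendsto_intros) (simp_all del: of_nat_Suc)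
      then show ?thesis by simp
    qed
    show "\<forall>\<^sub>F \<sigma> in at_right 0. (\<Sum>n<M. (cmod (d (Suc n)))\<^sup>2 * real (Suc n) powr (-2 * \<sigma>)) \<le> K"
      using eventually_at_right_real[of 0 1, OF zero_less_one]
      by eventually_elim (rule bessel, auto)
  qed simp
  have summ: "summable (\<lambda>n. (cmod (d (Suc n)))\<^sup>2)"
    by (rule summableI_nonneg_bounded[OF _ sq]) simp
  have "dirichlet_term d s sums F s" if s: "s \<in> half_plane (1/2)" for s
  proof -
    have "dirichlet d s = F s"
    proof (rule analytic_continuation_open[of "half_plane 5" "half_plane (1/2)" "dirichlet d" F])
      show "half_plane 5 \<noteq> {}"
        by (auto simp: half_plane_def intro!: exI[of _ 6])
      show "dirichlet d holomorphic_on half_plane (1/2)"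
        by (rule dirichlet_holomorphic_l2[OF summ])
      show "F holomorphic_on half_plane (1/2)"
        by (rule holomorphic_on_subset[OF F_holo]) (auto simp: half_plane_def)
      show "dirichlet d z = F z" if "z \<in> half_plane 5" for z
        using d(2)[of z] that by (simp add: half_plane_def dirichlet_def sums_iff)
    qed (use s in \<open>auto simp: half_plane_properties, auto simp: half_plane_def\<close>)
    moreover have "summable (dirichlet_term d s)"
      using s by (intro summable_norm_cancel[OF summable_dirichlet_term_l2[OF summ]]) (simp add: half_plane_def)
    ultimately show ?thesis
      by (simp add: dirichlet_def sums_iff)
  qed
  then show ?thesis
    using that d(1) sq cont3 unfolding K_def by blast
qed

lemma norm_dirichlet_le:
  assumes d: "\<And>M. (\<Sum>n<M. (cmod (d (Suc n)))\<^sup>2) \<le> B" and s: "Re s > 1/2"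
    and sums: "dirichlet_term d s sums x"
  shows "(cmod x)\<^sup>2 \<le> B * (\<Sum>n. real (Suc n) powr (-2 * Re s))"
proof -
  have S: "summable (\<lambda>n. real (Suc n) powr (-2 * Re s))"
    using s by (intro summable_nat_powr) simp
  have "(cmod (\<Sum>n<M. dirichlet_term d s n))\<^sup>2 \<le> B * (\<Sum>n. real (Suc n) powr (-2 * Re s))" for M
  proof -
    have "cmod (\<Sum>n<M. dirichlet_term d s n) \<le> (\<Sum>n<M. cmod (d (Suc n)) * real (Suc n) powr (- Re s))"
      by (rule sum_norm_le) (simp only: norm_dirichlet_term order_refl)
    then have "(cmod (\<Sum>n<M. dirichlet_term d s n))\<^sup>2 \<le> (\<Sum>n<M. cmod (d (Suc n)) * real (Suc n) powr (- Re s))\<^sup>2"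
      by (intro power_mono) auto
    also have "\<dots> \<le> (\<Sum>n<M. (cmod (d (Suc n)))\<^sup>2) * (\<Sum>n<M. (real (Suc n) powr (- Re s))\<^sup>2)"
      by (rule Cauchy_Schwarz_ineq_sum)
    also have "(\<Sum>n<M. (real (Suc n) powr (- Re s))\<^sup>2) = (\<Sum>n<M. real (Suc n) powr (-2 * Re s))"
      by (simp add: power2_eq_square flip: powr_add del: of_nat_Suc)
    also have "(\<Sum>n<M. (cmod (d (Suc n)))\<^sup>2) * \<dots> \<le> B * (\<Sum>n. real (Suc n) powr (-2 * Re s))"
      using d[of 0] by (intro mult_mono d sum_le_suminf S sum_nonneg) auto
    finally show ?thesis .
  qed
  moreover have "(\<lambda>M. (cmod (\<Sum>n<M. dirichlet_term d s n))\<^sup>2) \<longlonglongrightarrow> (cmod x)\<^sup>2"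
    using sums unfolding sums_def by (intro tendsto_intros)
  ultimately show ?thesis
    by (intro LIMSEQ_le_const2) auto
qed

section \<open>Boundedness of the operator\<close>

text \<open>
  The images of the truncations of \<open>a\<close> form a Cauchy sequence in the space of square-summable
  coefficients: the bound for Dirichlet polynomials applies to the difference of two truncations, and its image is the
  difference of their images because coefficients are limits of means.  Evaluation at a point of
  \<open>half_plane (1/2)\<close> is continuous for both norms, which identifies the limit.
\<close>
lemma bounded_weighted_composition:
  fixes c0 :: nat and C :: real and c b :: "nat \<Rightarrow> complex"
  assumes gh: "gordon_hedenmalm c0 c" and c0: "c0 \<ge> 1" and C: "C > 0"
    and conv: "\<And>s. s \<in> half_plane 0 \<Longrightarrow> summable (dirichlet_term b s)"
    and psi: "\<And>s. s \<in> half_plane 0 \<Longrightarrow> cmod (dirichlet c s) \<le> C"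
    and u: "\<And>s. s \<in> half_plane 0 \<Longrightarrow> cmod (dirichlet b s) \<le> C * Re (gh_map c0 c s)"
  shows "bounded_A_to_H (weighted_composition (dirichlet b) (gh_map c0 c)) (12 * C * (real c0 + C))"
  unfolding bounded_A_to_H_def
proof
  fix a assume aA: "a \<in> A_space"
  define \<phi> where "\<phi> = gh_map c0 c"
  define K where "K = 144 * C\<^sup>2 * (real c0 + C)\<^sup>2"
  have K0: "K \<ge> 0" by (simp add: K_def)
  define W where "W = (\<lambda>n. A_weight n * (cmod (a (Suc n)))\<^sup>2)"
  have W0: "W n \<ge> 0" for n using A_weight_pos[of n] by (simp add: W_def)
  have Wsum: "summable W"
    using A_space_summable[OF aA] by (simp add: W_def)
  define F where "F = (\<lambda>N s. dirichlet b s * (\<Sum>n<N. dirichlet_term a (\<phi> s) n))"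
  have poly: "\<exists>d. (\<forall>n. (coeff_mean (F N) 3 n \<longlongrightarrow> d (Suc n)) at_top) \<and>
      (\<forall>s\<in>half_plane (1/2). dirichlet_term d s sums F N s) \<and>
      (\<forall>M. (\<Sum>n<M. (cmod (d (Suc n)))\<^sup>2) \<le> K * (\<Sum>n<N. W n))" (is ?A)
    and F_cont: "continuous_on {s. Re s \<ge> 3} (F N)" (is ?B) for N
  proof -
    obtain d where d: "\<And>n. (coeff_mean (F N) 3 n \<longlongrightarrow> d (Suc n)) at_top"
      "\<And>s. s \<in> half_plane (1/2) \<Longrightarrow> dirichlet_term d s sums F N s"
      "\<And>M. (\<Sum>n<M. (cmod (d (Suc n)))\<^sup>2) \<le> K * (\<Sum>n<N. W n)"
      "continuous_on {s. Re s \<ge> 3} (F N)"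
      unfolding F_def
      by (rule weighted_composition_dirichlet_polynomial[OF gh c0 C conv psi u, where N = N and a = a,
            folded \<phi>_def, folded K_def W_def]) blast+
    show ?B by (rule d(4))
    show ?A by (intro exI[of _ d] conjI allI ballI d(1-3))
  qed
  have poly_all: "\<forall>N. \<exists>d. (\<forall>n. (coeff_mean (F N) 3 n \<longlongrightarrow> d (Suc n)) at_top) \<and>
      (\<forall>s\<in>half_plane (1/2). dirichlet_term d s sums F N s) \<and>
      (\<forall>M. (\<Sum>n<M. (cmod (d (Suc n)))\<^sup>2) \<le> K * (\<Sum>n<N. W n))"
    using poly by blast
  from choice[OF poly_all] obtain d where
    d_lim: "\<And>N n. (coeff_mean (F N) 3 n \<longlongrightarrow> d N (Suc n)) at_top" and
    d_sums: "\<And>N s. s \<in> half_plane (1/2) \<Longrightarrow> dirichlet_term (d N) s sums F N s" and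
    d_le: "\<And>N M. (\<Sum>n<M. (cmod (d N (Suc n)))\<^sup>2) \<le> K * (\<Sum>n<N. W n)"
    by blast
  define \<tau> where "\<tau> = (\<lambda>N. \<Sum>n. W (n + N))"
  have tau: "\<tau> \<longlonglongrightarrow> 0"
    unfolding \<tau>_def using suminf_exist_split2[OF Wsum] .
  have diff: "(\<Sum>n<M. (cmod (d N' (Suc n) - d N (Suc n)))\<^sup>2) \<le> K * \<tau> N" if NN: "N \<le> N'" for N N' M
  proof -
    \<comment> \<open>The index \<open>j = n + 1\<close> is at most \<open>N\<close> exactly when \<open>n < N\<close>.\<close>
    define p where "p = (\<lambda>j. if j \<le> N then 0 else a j)"
    obtain e where e: "\<And>n. (coeff_mean (\<lambda>s. dirichlet b s * (\<Sum>n<N'. dirichlet_term p (\<phi> s) n)) 3 n \<longlongrightarrow> e (Suc n)) at_top"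
      "\<And>M. (\<Sum>n<M. (cmod (e (Suc n)))\<^sup>2) \<le> K * (\<Sum>n<N'. A_weight n * (cmod (p (Suc n)))\<^sup>2)"
      by (rule weighted_composition_dirichlet_polynomial[OF gh c0 C conv psi u, where N = N' and a = p,
            folded \<phi>_def, folded K_def]) blast+
    have pdiff: "dirichlet b s * (\<Sum>n<N'. dirichlet_term p (\<phi> s) n) = F N' s - F N s" for s
    proof -
      have "(\<Sum>n<N. dirichlet_term a (\<phi> s) n) = (\<Sum>n<N'. if n < N then dirichlet_term a (\<phi> s) n else 0)"
        using NN by (intro sum.mono_neutral_cong_left) auto
      moreover have "dirichlet_term p (\<phi> s) n = dirichlet_term a (\<phi> s) n - (if n < N then dirichlet_term a (\<phi> s) n else 0)" for n
        by (simp add: dirichlet_term_def p_def Suc_le_eq)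
      ultimately show ?thesis
        unfolding F_def right_diff_distrib[symmetric] by (simp add: sum_subtractf)
    qed
    have line: "continuous_on A (\<lambda>t. F N (Complex 3 t))" for A N
      by (intro continuous_on_compose2[OF F_cont] continuous_intros) auto
    have "e (Suc n) = d N' (Suc n) - d N (Suc n)" for n
    proof (rule tendsto_unique[OF _ e(1)])
      have cm: "coeff_mean (\<lambda>s. F N' s - F N s) 3 n T = coeff_mean (F N') 3 n T - coeff_mean (F N) 3 n T" for T
        unfolding coeff_mean_def diff_divide_distrib[symmetric] left_diff_distrib
        by (subst integral_diff) (intro integrable_continuous_interval continuous_intros line refl)+
      show "(coeff_mean (\<lambda>s. dirichlet b s * (\<Sum>n<N'. dirichlet_term p (\<phi> s) n)) 3 n
          \<longlongrightarrow> d N' (Suc n) - d N (Suc n)) at_top"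
        unfolding pdiff cm[abs_def] by (intro tendsto_diff d_lim)
    qed simp
    then have "(\<Sum>n<M. (cmod (d N' (Suc n) - d N (Suc n)))\<^sup>2) \<le> K * (\<Sum>n<N'. A_weight n * (cmod (p (Suc n)))\<^sup>2)"
      using e(2)[of M] by simp
    also have "(\<Sum>n<N'. A_weight n * (cmod (p (Suc n)))\<^sup>2) = (\<Sum>n\<in>{N..<N'}. W n)"
      by (rule sum.mono_neutral_cong_right) (auto simp: p_def W_def)
    also have "\<dots> = (\<Sum>n<N' - N. W (n + N))"
      using sum.shift_bounds_nat_ivl[of W 0 N "N' - N"] NN by (simp add: lessThan_atLeast0)
    also have "K * \<dots> \<le> K * \<tau> N"
      unfolding \<tau>_def using Wsum W0 by (intro mult_left_mono sum_le_suminf summable_ignore_initial_segment K0) auto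
    finally show ?thesis .
  qed
  have "\<exists>l. (\<lambda>N. d N (Suc n)) \<longlonglongrightarrow> l" for n
  proof -
    have "Cauchy (\<lambda>N. d N (Suc n))"
    proof (rule metric_CauchyI)
      fix \<epsilon> :: real assume eps: "\<epsilon> > 0"
      have "(\<lambda>N. K * \<tau> N) \<longlonglongrightarrow> K * 0"
        by (intro tendsto_intros tau)
      then have "\<forall>\<^sub>F N in sequentially. K * \<tau> N < (\<epsilon> / 2)\<^sup>2"
        using eps by (intro order_tendstoD(2)) auto
      then obtain N where N: "K * \<tau> N < (\<epsilon> / 2)\<^sup>2"
        using eventually_happens'[OF sequentially_bot] by blast
      have near: "cmod (d N' (Suc n) - d N (Suc n)) < \<epsilon> / 2" if "N' \<ge> N" for N'
      proof -
        have "(cmod (d N' (Suc n) - d N (Suc n)))\<^sup>2 \<le> (\<Sum>n<Suc n. (cmod (d N' (Suc n) - d N (Suc n)))\<^sup>2)"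
          by (simp add: sum_nonneg)
        also have "\<dots> < (\<epsilon> / 2)\<^sup>2"
          using diff[OF that, of "Suc n"] N by linarith
        finally show ?thesis
          using eps by (intro power_less_imp_less_base[of _ 2 "\<epsilon> / 2"]) auto
      qed
      have "dist (d i (Suc n)) (d j (Suc n)) < \<epsilon>" if "i \<ge> N" "j \<ge> N" for i j
        using near[OF that(1)] near[OF that(2)] dist_triangle2[of "d i (Suc n)" "d j (Suc n)" "d N (Suc n)"]
        by (simp add: dist_norm)
      then show "\<exists>M. \<forall>m\<ge>M. \<forall>k\<ge>M. dist (d m (Suc n)) (d k (Suc n)) < \<epsilon>" by blast
    qed
    then show ?thesis by (simp add: Cauchy_convergent_iff convergent_def)
  qed
  then obtain l where l: "\<And>n. (\<lambda>N. d N (Suc n)) \<longlonglongrightarrow> l n" by metis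
  define \<beta> where "\<beta> = (\<lambda>m. l (m - 1))"
  have beta: "(\<lambda>N. d N (Suc n)) \<longlonglongrightarrow> \<beta> (Suc n)" for n
    using l by (simp add: \<beta>_def)
  have beta_diff: "(\<Sum>n<M. (cmod (\<beta> (Suc n) - d N (Suc n)))\<^sup>2) \<le> K * \<tau> N" for M N
  proof (rule LIMSEQ_le_const2)
    show "(\<lambda>N'. \<Sum>n<M. (cmod (d N' (Suc n) - d N (Suc n)))\<^sup>2) \<longlonglongrightarrow> (\<Sum>n<M. (cmod (\<beta> (Suc n) - d N (Suc n)))\<^sup>2)"
      by (intro tendsto_intros beta)
    show "\<exists>N0. \<forall>N'\<ge>N0. (\<Sum>n<M. (cmod (d N' (Suc n) - d N (Suc n)))\<^sup>2) \<le> K * \<tau> N"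
      using diff by blast
  qed
  have beta_le: "(\<Sum>n<M. (cmod (\<beta> (Suc n)))\<^sup>2) \<le> K * suminf W" for M
  proof (rule LIMSEQ_le_const2)
    show "(\<lambda>N. \<Sum>n<M. (cmod (d N (Suc n)))\<^sup>2) \<longlonglongrightarrow> (\<Sum>n<M. (cmod (\<beta> (Suc n)))\<^sup>2)"
      by (intro tendsto_intros beta)
    have "(\<Sum>n<M. (cmod (d N (Suc n)))\<^sup>2) \<le> K * suminf W" for N
    proof -
      have "K * (\<Sum>n<N. W n) \<le> K * suminf W"
        using Wsum W0 by (intro mult_left_mono sum_le_suminf K0) auto
      then show ?thesis using d_le order_trans by blast
    qed
    then show "\<exists>N0. \<forall>N\<ge>N0. (\<Sum>n<M. (cmod (d N (Suc n)))\<^sup>2) \<le> K * suminf W" by blast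
  qed
  have beta_summable: "summable (\<lambda>n. (cmod (\<beta> (Suc n)))\<^sup>2)"
    by (rule summableI_nonneg_bounded[OF _ beta_le]) simp
  have image: "weighted_composition (dirichlet b) \<phi> (dirichlet a) s = dirichlet \<beta> s"
    if s: "s \<in> half_plane (1/2)" for s
  proof -
    have Re_s: "Re s > 1/2" using s by (simp add: half_plane_def)
    have "\<phi> s \<in> half_plane (1/2)"
      using gh s unfolding gordon_hedenmalm_def \<phi>_def by blast
    then have "summable (dirichlet_term a (\<phi> s))"
      using Wsum unfolding W_def by (intro summable_dirichlet_term_A_weight) (simp_all add: half_plane_def)
    then have "(\<lambda>N. \<Sum>n<N. dirichlet_term a (\<phi> s) n) \<longlonglongrightarrow> dirichlet a (\<phi> s)"
      unfolding dirichlet_def by (rule summable_LIMSEQ)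
    then have lim1: "(\<lambda>N. F N s) \<longlonglongrightarrow> dirichlet b s * dirichlet a (\<phi> s)"
      unfolding F_def by (intro tendsto_intros)
    have beta_sums: "dirichlet_term \<beta> s sums dirichlet \<beta> s"
      unfolding dirichlet_def
      by (intro summable_sums summable_norm_cancel[OF summable_dirichlet_term_l2[OF beta_summable Re_s]])
    define Z where "Z = (\<Sum>n. real (Suc n) powr (-2 * Re s))"
    have "(cmod (dirichlet \<beta> s - F N s))\<^sup>2 \<le> K * \<tau> N * Z" for N
      unfolding Z_def
    proof (rule norm_dirichlet_le[OF _ Re_s])
      show "(\<Sum>n<M. (cmod ((\<lambda>n. \<beta> n - d N n) (Suc n)))\<^sup>2) \<le> K * \<tau> N" for M
        using beta_diff by simp
      show "dirichlet_term (\<lambda>n. \<beta> n - d N n) s sums (dirichlet \<beta> s - F N s)"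
        using sums_diff[OF beta_sums d_sums[OF s, of N]]
        by (simp add: dirichlet_term_def[abs_def] left_diff_distrib)
    qed
    moreover have "(\<lambda>N. K * \<tau> N * Z) \<longlonglongrightarrow> K * 0 * Z"
      by (intro tendsto_intros tau)
    ultimately have "(\<lambda>N. (cmod (dirichlet \<beta> s - F N s))\<^sup>2) \<longlonglongrightarrow> 0"
      by (intro Lim_null_comparison[of "\<lambda>N. (cmod (dirichlet \<beta> s - F N s))\<^sup>2" "\<lambda>N. K * \<tau> N * Z"]) auto
    from tendsto_real_sqrt[OF this] have "(\<lambda>N. cmod (dirichlet \<beta> s - F N s)) \<longlonglongrightarrow> 0"
      by simp
    then have "(\<lambda>N. dirichlet \<beta> s - F N s) \<longlonglongrightarrow> 0"
      by (rule tendsto_norm_zero_cancel)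
    from tendsto_diff[OF tendsto_const[of "dirichlet \<beta> s"] this]
    have "(\<lambda>N. F N s) \<longlonglongrightarrow> dirichlet \<beta> s"
      by simp
    from LIMSEQ_unique[OF lim1 this] show ?thesis
      by (simp add: weighted_composition_def)
  qed
  have "H_norm \<beta> = sqrt (\<Sum>n. (cmod (\<beta> (Suc n)))\<^sup>2)"
    by (rule H_norm_eq(2)[OF beta_summable])
  also have "\<dots> \<le> sqrt (K * suminf W)"
    by (intro real_sqrt_le_mono suminf_le_const beta_summable beta_le)
  also have "\<dots> = 12 * C * (real c0 + C) * sqrt (suminf W)"
  proof -
    have "sqrt K = 12 * C * (real c0 + C)"
      using C by (intro real_sqrt_unique) (auto simp: K_def power_mult_distrib)
    then show ?thesis by (simp add: real_sqrt_mult)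
  qed
  also have "sqrt (suminf W) = A_norm a"
    using A_norm_eq[of a] Wsum by (simp add: W_def)
  finally show "\<exists>b'\<in>H_space. (\<forall>s\<in>half_plane (1/2).
        weighted_composition (dirichlet b) (gh_map c0 c) (dirichlet a) s = dirichlet b' s) \<and>
      H_norm b' \<le> 12 * C * (real c0 + C) * A_norm a"
    using image H_norm_eq(1)[OF beta_summable] by (auto simp: \<phi>_def)
qed

theorem theorem5p3:
  fixes c0 :: nat and C :: real
  assumes "c0 \<ge> 1" and "C > 0"
  shows "\<exists>A>0. \<forall>(c :: nat \<Rightarrow> complex) (b :: nat \<Rightarrow> complex).
           gordon_hedenmalm c0 c \<longrightarrow>
           (\<forall>s\<in>half_plane 0. summable (dirichlet_term b s)) \<longrightarrow>
           (\<forall>s\<in>half_plane 0. cmod (deriv (dirichlet b) s) \<le> C) \<longrightarrow>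
           (\<forall>s\<in>half_plane 0. cmod (dirichlet c s) \<le> C) \<longrightarrow>
           (\<forall>s\<in>half_plane 0. cmod (dirichlet b s) \<le> C * Re (gh_map c0 c s)) \<longrightarrow>
           bounded_A_to_H (weighted_composition (dirichlet b) (gh_map c0 c)) A"
proof (intro exI[of _ "12 * C * (real c0 + C)"] conjI allI impI)
  show "12 * C * (real c0 + C) > 0"
    using assms by simp
next
  fix c b :: "nat \<Rightarrow> complex"
  assume "gordon_hedenmalm c0 c"
    and "\<forall>s\<in>half_plane 0. summable (dirichlet_term b s)"
    and "\<forall>s\<in>half_plane 0. cmod (dirichlet c s) \<le> C"
    and "\<forall>s\<in>half_plane 0. cmod (dirichlet b s) \<le> C * Re (gh_map c0 c s)"
  then show "bounded_A_to_H (weighted_composition (dirichlet b) (gh_map c0 c)) (12 * C * (real c0 + C))"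
    by (intro bounded_weighted_composition assms) simp_all
qed

end
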